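(* Assume the standing setting and assumptions (A1)–(A4) described in the context. If $(\mu,m)\in\mathcal R$, then there exists a tuple $(\overline\Omega,\overline{\mathcal F},\overline{\mathbb F},\overline{\mathbb P},\overline\tau,\overline X,\overline U)$ such that: (1) $(\overline\Omega,\overline{\mathcal F},\overline{\mathbb P})$ is a complete probability space endowed with a complete filtration $\overline{\mathbb F}$ and supporting the random variables $(\overline\tau,\overline X,\overline U)$. (2) $(\overline X,\overline U)$ is an $\overline{\mathbb F}$-Markov chain with values in $E\times W$, with transition kernels $(\pi_t)_{t\in I^*}$ and initial distribution $m_0^*(u)(dx)\,p_0(u)$. (3) $\overline\tau$ is an $\overline{\mathbb F}$-stopping time with values in $I$ such that $\overline\tau\le\tau_D^{\overline X}$. (4) The measures have the representation $$m_t(u)(B)=\overline{\mathbb P}[\overline X_t\in B,\ t<\overline\tau\mid\overline U_t=u],\quad B\in\mathcal B(D),\ t\in I\setminus\{T\},\ u\in\Omega_t,$$ $$\mu_t(u)(B)=\overline{\mathbb P}[\overline X_t\in B,\ \overline\tau=t\mid\overline U_t=u],\quad B\in\mathcal B(E),\ t\in I,\ u\in\Omega_t.$$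
   Context: Setting. $T\in\mathbb N^*$, $I=\{0,\dots,T\}$, $I^*=\{1,\dots,T\}$. $(E,d)$ is a nonempty compact metric space, $D\subset E$ a nonempty compact set, $H=\{z_j: j\in\mathcal I\}$ a nonempty finite set with distinct elements, $\mathcal I=\{1,\dots,|H|\}$. $(\Omega,\mathcal F,\mathbb F,\mathbb P)$ is a complete filtered probability space carrying $\mathbb F$-adapted processes $X=(X_t)_{t\in I}$ with values in $E$ and $Z=(Z_t)_{t\in I}$ (common noise) with values in $H$. For an $E$-valued process $Y=(Y_t)_{t\in I}$, $\tau_D^Y:=\inf\{t\in I:Y_t\notin D\}$ with $\inf\emptyset=\infty$. The process $U$ takes values in $W:=\{0,1\}^{(T+1)\times|H|}$ (matrices with entries $0$ or $1$): $U_t(s+1,j)=\mathbf 1_{s\le t}\mathbf 1_{Z_s=z_j}$ for $(s,j)\in I\times\mathcal I$, $t\in I$. Finite sets carry the discrete topology. $\Omega_t:=\{u\in W:\mathbb P(U_t=u)>0\}$, $p_t(u):=\mathbb P(U_t=u)$, and $m_0^*(u)(B):=\mathbb P(X_0\in B\mid U_0=u)$ for $u\in\Omega_0$. Assumptions. (A1) $X_0\in D$ a.s. (A2) $(X,U)$ is an $\mathbb F$-Markov chain with transition kernels $(\pi_t)_{t\in I^*}$ on $E\times W$ (i.e. $\pi_t(X_{t-1},U_{t-1};\cdot)$ is the conditional law of $(X_t,U_t)$ given $\mathcal F_{t-1}$) such that $\pi_t(x,u;E\times\{u'\})=\pi_t(\bar x,u;E\times\{u'\})$ for all $t\in I^*$,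 $x,\bar x\in E$, $u,u'\in W$. (A3) For each $t\in I^*$, $\pi_t:E\times W\to\mathcal P(E\times W)$ is continuous (weak convergence on the target). (A4) For each $t$, the reward functions $f_t:D\times W\times\mathcal P^{sub}(D)\to\mathbb R$ ($t\in I\setminus\{T\}$) and $g_t:E\times W\times\mathcal P^{sub}(E)\to\mathbb R$ ($t\in I$) are continuous. Here $\mathcal P^{sub}(K)$ is the set of Borel subprobability measures on $K$ with the topology of weak convergence. Operator: for $\varphi\in C(I\times E\times W)$, $t\in I\setminus\{T\}$, $$\mathcal L(\varphi)(t,x,u):=\int_{E\times W}[\varphi(t+1,x',u')-\varphi(t,x,u)]\,\pi_{t+1}(x,u;dx',du').$$ Constraint set: $\mathcal R$ is the set of pairs $(\mu,m)\in\mathcal C_\mu\times\mathcal C_m$, $\mathcal C_\mu:=\prod_{t\in I}\mathcal P^{sub}(E)^{\Omega_t}$, $\mathcal C_m:=\prod_{t\in I\setminus\{T\}}\mathcal P^{sub}(D)^{\Omega_t}$ ($\mathcal Y^{\mathcal X}$ denotes functions from $\mathcal X$ to $\mathcal Y$), such that for all $\varphi\in C(I\times E\times W)$, $$\sum_{t=0}^T\sum_{u\in\Omega_t}p_t(u)\int_E\varphi(t,x,u)\mu_t(u)(dx)=\sum_{u\in\Omega_0}p_0(u)\int_D\varphi(0,x,u)m_0^*(u)(dx)+\sum_{t=0}^{T-1}\sum_{u\in\Omega_t}p_t(u)\int_D\mathcal L(\varphi)(t,x,u)m_t(u)(dx).$$ *)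

theory Defs
  imports "HOL-Probability.Probability"
begin

subsection \<open>Filtered probability spaces and stopping\<close>

text \<open>
  Time runs through \<open>{0..T}\<close>. Only \<open>F 0, \<dots>, F T\<close> are constrained: the library notions for the index
  type \<^typ>\<open>nat\<close> are applied to the family frozen at \<open>T\<close>.
\<close>

definition complete_filtered_prob_space :: "nat \<Rightarrow> 'a measure \<Rightarrow> (nat \<Rightarrow> 'a measure) \<Rightarrow> bool" where
  "complete_filtered_prob_space T M F \<longleftrightarrow>
     prob_space M \<and> complete_measure M \<and>
     filtration (space M) (\<lambda>t. F (min t T)) \<and>
     (\<forall>t\<in>{0..T}. sets (F t) \<subseteq> sets M \<and> null_sets M \<subseteq> sets (F t))"

definition stopping_time_upto :: "nat \<Rightarrow> (nat \<Rightarrow> 'a measure) \<Rightarrow> 'a measure \<Rightarrow> ('a \<Rightarrow> nat) \<Rightarrow> bool" where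
  "stopping_time_upto T F M \<tau> \<longleftrightarrow>
     stopping_time (\<lambda>t. F (min t T)) \<tau> \<and> (\<forall>\<omega>\<in>space M. \<tau> \<omega> \<in> {0..T})"

text \<open>The infimum of the empty set in \<^typ>\<open>enat\<close> is \<open>\<infinity>\<close>.\<close>

definition exit_time :: "nat \<Rightarrow> 'e set \<Rightarrow> (nat \<Rightarrow> 'a \<Rightarrow> 'e) \<Rightarrow> 'a \<Rightarrow> enat" where
  "exit_time T D Y \<omega> = (INF t\<in>{t\<in>{0..T}. Y t \<omega> \<notin> D}. enat t)"

subsection \<open>Measures on compact spaces and weak convergence\<close>

text \<open>
  The finite set \<open>W\<close> is discrete, so the product \<open>\<sigma>\<close>-algebra below is the Borel \<open>\<sigma>\<close>-algebra of
  \<open>E \<times> W\<close>. The space \<open>E\<close> is the whole type \<open>'e\<close>.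
\<close>

definition state_algebra :: "'u set \<Rightarrow> ('e::topological_space \<times> 'u) measure" where
  "state_algebra W = borel \<Otimes>\<^sub>M count_space W"

definition state_topology :: "'u set \<Rightarrow> ('e::topological_space \<times> 'u) topology" where
  "state_topology W = prod_topology euclidean (discrete_topology W)"

definition subprobs :: "'e::topological_space set \<Rightarrow> 'e measure set" where
  "subprobs K = space (subprob_algebra (restrict_space borel K))"

text \<open>
  The topology of weak convergence on a set \<open>P\<close> of finite Borel measures on \<open>X\<close>: the coarsest one
  for which integration of every bounded continuous function is continuous.
\<close>

definition weak_topology :: "'a topology \<Rightarrow> 'a measure set \<Rightarrow> 'a measure topology" where
  "weak_topology X P = topology_generated_by
     {{N\<in>P. (\<integral>x. h x \<partial>N) \<in> V} | h V.
        continuous_map X euclideanreal h \<and> bounded (h ` topspace X) \<and> open V}"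

abbreviation subprob_topology :: "'e::topological_space set \<Rightarrow> 'e measure topology" where
  "subprob_topology K \<equiv> weak_topology (top_of_set K) (subprobs K)"

lemma topspace_weak_topology [simp]: "topspace (weak_topology X P) = P"
proof -
  have "\<exists>h V. P = {N\<in>P. (\<integral>x. h x \<partial>N) \<in> V} \<and>
      continuous_map X euclideanreal h \<and> bounded (h ` topspace X) \<and> open V"
    by (intro exI[of _ "\<lambda>_. 0"] exI[of _ UNIV]) (auto simp: bounded_iff)
  then show ?thesis
    unfolding weak_topology_def topology_generated_by_topspace by blast
qed

subsection \<open>The common noise matrix\<close>

text \<open>
  A matrix with \<open>T + 1\<close> rows and \<open>n\<close> columns is an extensional function on
  \<open>{1..T+1} \<times> {1..n}\<close>; row \<open>s + 1\<close> belongs to time \<open>s\<close>.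
\<close>

type_synonym noise_matrix = "nat \<times> nat \<Rightarrow> nat"

definition noise_matrices :: "nat \<Rightarrow> nat \<Rightarrow> noise_matrix set" where
  "noise_matrices T n = {1..T+1} \<times> {1..n} \<rightarrow>\<^sub>E {0, 1}"

definition noise_process ::
    "nat \<Rightarrow> nat \<Rightarrow> (nat \<Rightarrow> 'h) \<Rightarrow> (nat \<Rightarrow> 'a \<Rightarrow> 'h) \<Rightarrow> nat \<Rightarrow> 'a \<Rightarrow> noise_matrix" where
  "noise_process T n z Z t \<omega> =
     restrict (\<lambda>(i, j). of_bool (i - 1 \<le> t) * of_bool (Z (i - 1) \<omega> = z j)) ({1..T+1} \<times> {1..n})"

definition noise_prob :: "'a measure \<Rightarrow> (nat \<Rightarrow> 'a \<Rightarrow> 'u) \<Rightarrow> nat \<Rightarrow> 'u \<Rightarrow> real" where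
  "noise_prob M U t u = \<P>(\<omega> in M. U t \<omega> = u)"

definition noise_supp :: "'u set \<Rightarrow> 'a measure \<Rightarrow> (nat \<Rightarrow> 'a \<Rightarrow> 'u) \<Rightarrow> nat \<Rightarrow> 'u set" where
  "noise_supp W M U t = {u\<in>W. noise_prob M U t u > 0}"

text \<open>The conditional law of \<open>X 0\<close> given \<open>U 0 = u\<close>.\<close>

definition init_cond_law ::
    "'a measure \<Rightarrow> (nat \<Rightarrow> 'a \<Rightarrow> 'e::topological_space) \<Rightarrow> (nat \<Rightarrow> 'a \<Rightarrow> 'u) \<Rightarrow> 'u \<Rightarrow> 'e measure" where
  "init_cond_law M X U u =
     distr (uniform_measure M {\<omega>\<in>space M. U 0 \<omega> = u}) borel (X 0)"

lemma measure_init_cond_law: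
  assumes "prob_space M" "X 0 \<in> M \<rightarrow>\<^sub>M borel" "{\<omega>\<in>space M. U 0 \<omega> = u} \<in> sets M"
    and "noise_prob M U 0 u > 0" "B \<in> sets borel"
  shows "measure (init_cond_law M X U u) B = \<P>(\<omega> in M. X 0 \<omega> \<in> B \<bar> U 0 \<omega> = u)"
proof -
  interpret prob_space M by fact
  let ?A = "{\<omega>\<in>space M. U 0 \<omega> = u}"
  have A: "emeasure M ?A \<noteq> 0" "emeasure M ?A \<noteq> \<infinity>"
    using assms(4) by (auto simp: noise_prob_def measure_def)
  have B: "X 0 -` B \<inter> space M \<in> sets M"
    using assms(2,5) by (rule measurable_sets)
  have eq: "?A \<inter> (X 0 -` B \<inter> space M) = {\<omega>\<in>space M. X 0 \<omega> \<in> B \<and> U 0 \<omega> = u}"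
    by auto
  have "measure (init_cond_law M X U u) B = measure (uniform_measure M ?A) (X 0 -` B \<inter> space M)"
    unfolding init_cond_law_def using assms(2,5) by (subst measure_distr) auto
  also have "\<dots> = measure M (?A \<inter> (X 0 -` B \<inter> space M)) / measure M ?A"
    using A B by (rule measure_uniform_measure)
  finally show ?thesis
    unfolding eq cond_prob_def .
qed

subsection \<open>Markov chains\<close>

definition markov_chain ::
    "nat \<Rightarrow> 'u set \<Rightarrow> 'a measure \<Rightarrow> (nat \<Rightarrow> 'a measure) \<Rightarrow>
     (nat \<Rightarrow> 'e::topological_space \<times> 'u \<Rightarrow> ('e \<times> 'u) measure) \<Rightarrow>
     (nat \<Rightarrow> 'a \<Rightarrow> 'e) \<Rightarrow> (nat \<Rightarrow> 'a \<Rightarrow> 'u) \<Rightarrow> bool" where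
  "markov_chain T W M F \<pi> X U \<longleftrightarrow>
     (\<forall>t\<in>{0..T}. (\<lambda>\<omega>. (X t \<omega>, U t \<omega>)) \<in> F t \<rightarrow>\<^sub>M state_algebra W) \<and>
     (\<forall>t\<in>{1..T}. \<pi> t \<in> state_algebra W \<rightarrow>\<^sub>M prob_algebra (state_algebra W)) \<and>
     (\<forall>t\<in>{1..T}. \<forall>A\<in>sets (state_algebra W).
        AE \<omega> in M. real_cond_exp M (F (t - 1)) (\<lambda>\<omega>'. indicator A (X t \<omega>', U t \<omega>')) \<omega>
                   = measure (\<pi> t (X (t - 1) \<omega>, U (t - 1) \<omega>)) A)"

subsection \<open>The constraint set\<close>

definition generator ::
    "(nat \<Rightarrow> 'e \<times> 'u \<Rightarrow> ('e \<times> 'u) measure) \<Rightarrow> (nat \<times> 'e \<times> 'u \<Rightarrow> real) \<Rightarrow> nat \<times> 'e \<times> 'u \<Rightarrow> real" where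
  "generator \<pi> \<phi> = (\<lambda>(t, x, u). \<integral>(x', u'). (\<phi> (t + 1, x', u') - \<phi> (t, x, u)) \<partial>\<pi> (t + 1) (x, u))"

definition constraint_set ::
    "nat \<Rightarrow> 'e::topological_space set \<Rightarrow> 'u set \<Rightarrow> 'a measure \<Rightarrow>
     (nat \<Rightarrow> 'a \<Rightarrow> 'e) \<Rightarrow> (nat \<Rightarrow> 'a \<Rightarrow> 'u) \<Rightarrow>
     (nat \<Rightarrow> 'e \<times> 'u \<Rightarrow> ('e \<times> 'u) measure) \<Rightarrow>
     ((nat \<Rightarrow> 'u \<Rightarrow> 'e measure) \<times> (nat \<Rightarrow> 'u \<Rightarrow> 'e measure)) set" where
  "constraint_set T D W M X U \<pi> =
     {(\<mu>, m) \<in> (\<Pi>\<^sub>E t\<in>{0..T}. \<Pi>\<^sub>E u\<in>noise_supp W M U t. subprobs UNIV) \<times>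
               (\<Pi>\<^sub>E t\<in>{0..<T}. \<Pi>\<^sub>E u\<in>noise_supp W M U t. subprobs D).
      \<forall>\<phi>. continuous_map (prod_topology (discrete_topology {0..T}) (state_topology W)) euclideanreal \<phi> \<longrightarrow>
        (\<Sum>t=0..T. \<Sum>u\<in>noise_supp W M U t. noise_prob M U t u * (\<integral>x. \<phi> (t, x, u) \<partial>\<mu> t u))
        = (\<Sum>u\<in>noise_supp W M U 0. noise_prob M U 0 u *
             (LINT x:D|init_cond_law M X U u. \<phi> (0, x, u)))
          + (\<Sum>t\<in>{0..<T}. \<Sum>u\<in>noise_supp W M U t. noise_prob M U t u *
               (\<integral>x. generator \<pi> \<phi> (t, x, u) \<partial>m t u))}"

end

theory Submission
  imports Defs
begin

text \<open>
  A pair \<open>(\<mu>, m)\<close> in the constraint set describes a flow of mass on \<open>E \<times> W\<close>. Weighting the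
  fibres over \<open>u\<close> by \<open>noise_prob M U t u\<close> turns \<open>m t\<close> and \<open>\<mu> t\<close> into measures \<open>m\<^sub>t\<close> (mass that is
  still running after time \<open>t\<close>) and \<open>\<mu>\<^sub>t\<close> (mass that stops at time \<open>t\<close>) on the state space. The
  generator couples only consecutive times, so testing the constraint with functions that live on one
  time and one value of the noise gives the balance equations
  \<open>\<mu>\<^sub>t + m\<^sub>t = \<lambda>\<^sub>t\<close>, where the arriving mass \<open>\<lambda>\<^sub>t\<close> is the law of \<open>(X\<^sub>0, U\<^sub>0)\<close> for \<open>t = 0\<close>, is
  \<open>m\<^bsub>t-1\<^esub> \<pi>\<^sub>t\<close> for \<open>t > 0\<close>, and \<open>m\<^sub>T = 0\<close> (lemmas \<open>constraint_balance\<close> and \<open>mass_balance\<close>).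

  Hence \<open>m\<^sub>t \<le> \<lambda>\<^sub>t\<close>, and \<open>m\<^sub>t\<close> has a density \<open>a\<^sub>t\<close> with values in \<open>[0, 1]\<close> with respect to \<open>\<lambda>\<^sub>t\<close>. This
  density is a survival probability: run the Markov chain with kernels \<open>\<pi>\<^sub>t\<close>, attach to every time
  an independent mark \<open>\<xi>\<^sub>t\<close>, uniform on the unit interval, and stop at the first time at which
  \<open>0 \<le> \<xi>\<^sub>t < a\<^sub>t(X\<^sub>t, U\<^sub>t)\<close> fails. By induction on \<open>t\<close>, the law of the state on the event that the
  chain has not stopped before \<open>t\<close> is \<open>\<lambda>\<^sub>t\<close>, and on the event that it has not stopped up to and
  including \<open>t\<close> it is \<open>a\<^sub>t \<lambda>\<^sub>t = m\<^sub>t\<close> (lemmas \<open>nn_integral_arrival\<close> and \<open>nn_integral_survival\<close>); the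
  difference is \<open>\<mu>\<^sub>t\<close>. Since \<open>m\<^sub>t\<close> lives on \<open>D\<close>, \<open>a\<^sub>t\<close> can be taken to vanish off \<open>D\<close>, which forces
  the chain to stop no later than its exit from \<open>D\<close>, and \<open>a\<^sub>T = 0\<close> forces it to stop by \<open>T\<close>.

  Dividing by \<open>\<P>(U'\<^sub>t = u)\<close> gives the conditional probabilities in the representation. This
  probability is again \<open>noise_prob M U t u\<close>, because two Markov chains with the same kernels and the
  same initial law have the same marginals (lemma \<open>markov_chain_marginals_unique\<close>).

  The marked chain is built on the coordinate space by the theorem of Ionescu Tulcea. The marks up to
  time \<open>t\<close> belong to the filtration, yet the chain stays Markov, because the mark of time \<open>t\<close> is
  drawn independently of the past and does not enter the next transition. Completing the measure
  and adding its null sets to the filtration changes no conditional expectation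
  (lemma \<open>real_cond_exp_null_augmentation\<close>).
\<close>

section \<open>Augmenting a filtration by null sets\<close>

definition null_augmentation :: "'a measure \<Rightarrow> 'a measure \<Rightarrow> 'a measure" where
  "null_augmentation M G =
     sigma (space M) {A \<in> sets (completion M). \<exists>B\<in>sets G. sym_diff A B \<in> null_sets (completion M)}"

lemma space_null_augmentation [simp]: "space (null_augmentation M G) = space M"
  by (simp add: null_augmentation_def space_measure_of_conv)

text \<open>
  The sets that differ from a set of \<open>G\<close> by a null set already form a \<open>\<sigma>\<close>-algebra: symmetric
  differences are unchanged by complements and add up under countable unions.
\<close>

lemma sets_null_augmentation:
  assumes "subalgebra M G"
  shows "sets (null_augmentation M G) =
    {A \<in> sets (completion M). \<exists>B\<in>sets G. sym_diff A B \<in> null_sets (completion M)}" (is "_ = ?\<A>")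
proof -
  have sub: "sets G \<subseteq> sets (completion M)" and sp: "space G = space M"
    using assms by (auto simp: subalgebra_def)
  have "sigma_algebra (space M) ?\<A>"
  proof (rule sigma_algebra_iff2[THEN iffD2], intro conjI ballI allI impI)
    show "?\<A> \<subseteq> Pow (space M)"
      using sets.sets_into_space[of _ "completion M"] by auto
    show "{} \<in> ?\<A>" by (auto intro!: bexI[of _ "{}"])
  next
    fix A assume "A \<in> ?\<A>"
    then obtain B where A: "A \<in> sets (completion M)" and B: "B \<in> sets G" "sym_diff A B \<in> null_sets (completion M)"
      by auto
    have "sym_diff (space M - A) (space M - B) = sym_diff A B"
      using sets.sets_into_space[OF A] sets.sets_into_space[OF B(1)] sp by auto
    moreover have "space M - B \<in> sets G" using B(1) sp by (metis sets.compl_sets)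
    moreover have "space M - A \<in> sets (completion M)" using A by (metis sets.compl_sets space_completion)
    ultimately show "space M - A \<in> ?\<A>" using B(2) by (auto intro!: bexI[of _ "space M - B"])
  next
    fix A :: "nat \<Rightarrow> 'a set" assume "range A \<subseteq> ?\<A>"
    then have "\<forall>i. \<exists>B\<in>sets G. sym_diff (A i) B \<in> null_sets (completion M)"
      and A: "\<And>i. A i \<in> sets (completion M)" by auto
    then obtain B where B: "\<And>i. B i \<in> sets G" "\<And>i. sym_diff (A i) (B i) \<in> null_sets (completion M)"
      by metis
    have A': "(\<Union>i. A i) \<in> sets (completion M)" and B': "(\<Union>i. B i) \<in> sets G"
      using A B by (blast intro: sets.countable_UN)+
    have "sym_diff (\<Union>i. A i) (\<Union>i. B i) \<in> null_sets (completion M)"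
    proof (rule null_sets_subset)
      show "(\<Union>i. sym_diff (A i) (B i)) \<in> null_sets (completion M)" using B(2) by (rule null_sets_UN)
      show "sym_diff (\<Union>i. A i) (\<Union>i. B i) \<in> sets (completion M)"
        using A' B' sub by blast
    qed auto
    then show "(\<Union>i. A i) \<in> ?\<A>" using A' B' by blast
  qed
  then show ?thesis
    by (simp add: null_augmentation_def sigma_algebra.sigma_sets_eq sets_measure_of_conv
        sigma_algebra_iff2)
qed

lemma
  assumes "subalgebra M G"
  shows subalgebra_null_augmentation: "subalgebra (completion M) (null_augmentation M G)"
    and sets_le_null_augmentation: "sets G \<subseteq> sets (null_augmentation M G)"
    and null_sets_le_null_augmentation: "null_sets (completion M) \<subseteq> sets (null_augmentation M G)"
proof -
  show "subalgebra (completion M) (null_augmentation M G)"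
    using sets_null_augmentation[OF assms] by (auto simp: subalgebra_def)
  show "sets G \<subseteq> sets (null_augmentation M G)"
  proof
    fix B assume "B \<in> sets G"
    then show "B \<in> sets (null_augmentation M G)"
      using assms by (auto simp: sets_null_augmentation[OF assms] subalgebra_def intro!: bexI[of _ B])
  qed
  show "null_sets (completion M) \<subseteq> sets (null_augmentation M G)"
    by (auto simp: sets_null_augmentation[OF assms] intro!: bexI[of _ "{}"])
qed

lemma sets_null_augmentation_mono:
  assumes "subalgebra M G" "subalgebra M G'" "sets G \<subseteq> sets G'"
  shows "sets (null_augmentation M G) \<subseteq> sets (null_augmentation M G')"
  using assms by (auto simp: sets_null_augmentation)

lemma measurable_null_augmentation:
  assumes "subalgebra M G" "f \<in> G \<rightarrow>\<^sub>M N"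
  shows "f \<in> null_augmentation M G \<rightarrow>\<^sub>M N"
  using assms(2) sets_le_null_augmentation[OF assms(1)] assms(1)
  by (auto simp: measurable_def subalgebra_def)

lemma prob_space_completion:
  assumes "prob_space M"
  shows "prob_space (completion M)"
  using assms by (intro prob_spaceI) (simp add: prob_space.emeasure_space_1)

text \<open>
  Every set of the augmented \<open>\<sigma>\<close>-algebra can be exchanged for one of \<open>G\<close> without changing an
  integral, so the defining identity of a conditional expectation only has to be tested on \<open>G\<close>.
\<close>

lemma real_cond_exp_null_augmentation:
  fixes f g :: "'a \<Rightarrow> real"
  assumes "prob_space M" and G: "subalgebra M G"
    and f: "integrable M f" and g: "integrable M g" "g \<in> borel_measurable G"
    and eq: "\<And>B. B \<in> sets G \<Longrightarrow> (\<integral>\<omega>\<in>B. f \<omega> \<partial>M) = (\<integral>\<omega>\<in>B. g \<omega> \<partial>M)"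
  shows "AE \<omega> in completion M. real_cond_exp (completion M) (null_augmentation M G) f \<omega> = g \<omega>"
proof -
  interpret M: prob_space M by fact
  interpret C: prob_space "completion M" by (rule prob_space_completion) fact
  interpret finite_measure_subalgebra "completion M" "null_augmentation M G"
    by standard (rule subalgebra_null_augmentation[OF G])
  have bm: "f \<in> borel_measurable M" "g \<in> borel_measurable M" using f g by auto
  have int: "integrable (completion M) f" "integrable (completion M) g"
    using f g bm by (auto simp: integrable_completion)
  show ?thesis
  proof (rule real_cond_exp_charact)
    fix A assume "A \<in> sets (null_augmentation M G)"
    then obtain B where A: "A \<in> sets (completion M)" and B: "B \<in> sets G" and
      AB: "sym_diff A B \<in> null_sets (completion M)"
      by (auto simp: sets_null_augmentation[OF G])
    have BM: "B \<in> sets M" using B G by (auto simp: subalgebra_def)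
    have ae: "AE \<omega> in completion M. \<omega> \<in> A \<longleftrightarrow> \<omega> \<in> B"
      using AE_not_in[OF AB] by eventually_elim auto
    have *: "(\<integral>\<omega>\<in>A. h \<omega> \<partial>completion M) = (\<integral>\<omega>\<in>B. h \<omega> \<partial>M)"
      if h: "h \<in> borel_measurable M" for h :: "'a \<Rightarrow> real"
    proof -
      have "(\<integral>\<omega>\<in>A. h \<omega> \<partial>completion M) = (\<integral>\<omega>\<in>B. h \<omega> \<partial>completion M)"
        unfolding set_lebesgue_integral_def
      proof (rule integral_cong_AE)
        show "AE \<omega> in completion M. indicat_real A \<omega> *\<^sub>R h \<omega> = indicat_real B \<omega> *\<^sub>R h \<omega>"
          using ae by eventually_elim (auto simp: indicator_def)
        have [measurable]: "h \<in> borel_measurable (completion M)" "A \<in> sets (completion M)" "B \<in> sets (completion M)"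
          using h A BM by (auto intro: measurable_completion)
        show "(\<lambda>\<omega>. indicat_real A \<omega> *\<^sub>R h \<omega>) \<in> borel_measurable (completion M)"
          and "(\<lambda>\<omega>. indicat_real B \<omega> *\<^sub>R h \<omega>) \<in> borel_measurable (completion M)" by measurable
      qed
      also have "\<dots> = (\<integral>\<omega>\<in>B. h \<omega> \<partial>M)"
        unfolding set_lebesgue_integral_def using h BM by (intro integral_completion) simp
      finally show ?thesis .
    qed
    show "(\<integral>\<omega>\<in>A. f \<omega> \<partial>completion M) = (\<integral>\<omega>\<in>A. g \<omega> \<partial>completion M)"
      using eq[OF B] by (simp add: * bm)
  qed (use int measurable_null_augmentation[OF G g(2)] in auto)
qed

section \<open>Densities of dominated measures\<close>

text \<open>
  On the set where the Radon--Nikodym derivative \<open>f\<close> exceeds \<open>1\<close>, domination gives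
  \<open>\<integral> (f - 1) \<le> 0\<close>, so this set is null and \<open>f\<close> may be cut off at \<open>1\<close>.
\<close>

lemma density_of_dominated_measure:
  assumes "finite_measure N" and sets: "sets M = sets N"
    and le: "\<And>A. A \<in> sets N \<Longrightarrow> emeasure M A \<le> emeasure N A"
  shows "\<exists>a. a \<in> borel_measurable N \<and> (\<forall>x. 0 \<le> a x \<and> a x \<le> (1::real)) \<and>
    M = density N (\<lambda>x. ennreal (a x))"
proof -
  interpret N: finite_measure N by fact
  have "absolutely_continuous N M"
    using le sets by (auto simp: absolutely_continuous_def null_sets_def)
      (metis le_zero_eq)
  from N.Radon_Nikodym[OF this sets] obtain f where f[measurable]: "f \<in> borel_measurable N"
    and fM: "density N f = M" by blast
  define A where "A = {x \<in> space N. 1 < f x}"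
  have A[measurable]: "A \<in> sets N" unfolding A_def by measurable
  have "(\<integral>\<^sup>+x. (f x - 1) * indicator A x \<partial>N) + emeasure N A =
      (\<integral>\<^sup>+x. (f x - 1) * indicator A x + indicator A x \<partial>N)"
    by (simp add: nn_integral_add)
  also have "\<dots> = (\<integral>\<^sup>+x. f x * indicator A x \<partial>N)"
    by (intro nn_integral_cong) (auto simp: A_def indicator_def less_imp_le diff_add_cancel_ennreal)
  also have "\<dots> = emeasure M A"
    by (simp add: fM[symmetric] emeasure_density)
  also have "\<dots> \<le> emeasure N A" by (rule le) simp
  finally have "(\<integral>\<^sup>+x. (f x - 1) * indicator A x \<partial>N) = 0"
    using N.emeasure_finite[of A]
      ennreal_add_left_cancel_le[of "emeasure N A" "\<integral>\<^sup>+x. (f x - 1) * indicator A x \<partial>N" 0]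
    by (simp add: add.commute)
  then have "AE x in N. (f x - 1) * indicator A x = 0"
    by (simp add: nn_integral_0_iff_AE)
  moreover have "AE x in N. x \<in> space N" by (rule AE_space)
  ultimately have ae: "AE x in N. f x \<le> 1"
  proof eventually_elim
    case (elim x)
    show ?case
    proof (rule ccontr)
      assume "\<not> f x \<le> 1"
      then have "x \<in> A" using elim by (simp add: A_def)
      with elim have "f x - 1 = 0" by simp
      with \<open>\<not> f x \<le> 1\<close> show False by (simp add: ennreal_minus_eq_0)
    qed
  qed
  define a where "a x = (if f x \<le> 1 then enn2real (f x) else 1)" for x
  have "M = density N (\<lambda>x. ennreal (a x))"
    unfolding fM[symmetric]
  proof (rule density_cong)
    show "AE x in N. f x = ennreal (a x)"
      using ae
    proof eventually_elim
      case (elim x)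
      then have "f x < top" using order.strict_trans1[of "f x" 1 top] by simp
      with elim show ?case by (simp add: a_def)
    qed
  qed (auto simp: a_def[abs_def])
  moreover have "a x \<le> 1" for x
    using enn2real_mono[of "f x" 1] by (auto simp: a_def)
  moreover have "a \<in> borel_measurable N" unfolding a_def[abs_def] by measurable
  ultimately show ?thesis by (intro exI[of _ a]) (auto simp: a_def)
qed

section \<open>Measures determined by continuous functions\<close>

text \<open>
  In a metric space the indicator of a nonempty closed set \<open>C\<close> is the pointwise limit of the
  continuous functions \<open>max 0 (1 - n * infdist x C)\<close>, and the closed sets are an intersection-stable
  generator of the Borel sets.
\<close>

lemma finite_borel_measure_eqI:
  fixes M N :: "'e::metric_space measure"
  assumes "finite_measure M" and sets: "sets M = sets borel" "sets N = sets borel"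
    and eq: "\<And>h :: 'e \<Rightarrow> real. continuous_on UNIV h \<Longrightarrow> (\<And>x. 0 \<le> h x \<and> h x \<le> 1) \<Longrightarrow>
      (\<integral>\<^sup>+x. ennreal (h x) \<partial>M) = (\<integral>\<^sup>+x. ennreal (h x) \<partial>N)"
  shows "M = N"
proof -
  interpret M: finite_measure M by fact
  have lim: "(\<lambda>n. \<integral>\<^sup>+x. ennreal (max 0 (1 - real n * infdist x C)) \<partial>L) \<longlonglongrightarrow> emeasure L C"
    if C: "closed C" "C \<noteq> {}" and L: "sets L = sets borel" "emeasure L UNIV \<noteq> \<infinity>" for C and L :: "'e measure"
  proof -
    have [measurable]: "C \<in> sets L" using C L by simp
    have [measurable_cong]: "sets L = sets borel" by fact
    have "(\<lambda>n. \<integral>\<^sup>+x. ennreal (max 0 (1 - real n * infdist x C)) \<partial>L) \<longlonglongrightarrow> (\<integral>\<^sup>+x. indicator C x \<partial>L)"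
    proof (rule nn_integral_dominated_convergence[where w = "\<lambda>_. 1"])
      show "(\<lambda>x. ennreal (max 0 (1 - real n * infdist x C))) \<in> borel_measurable L" for n
      proof -
        have "(\<lambda>x. infdist x C) \<in> borel_measurable borel"
          by (intro borel_measurable_continuous_onI continuous_intros)
        then show ?thesis by measurable
      qed
      show "AE x in L. ennreal (max 0 (1 - real n * infdist x C)) \<le> 1" for n
        by (auto simp: infdist_nonneg ennreal_le_1 intro!: mult_nonneg_nonneg)
      show "(\<integral>\<^sup>+x. 1 \<partial>L) < \<infinity>"
        using L sets_eq_imp_space_eq[OF L(1)] by (simp add: top.not_eq_extremum)
      show "AE x in L. (\<lambda>n. ennreal (max 0 (1 - real n * infdist x C))) \<longlonglongrightarrow> indicator C x"
      proof (rule AE_I2)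
        fix x
        show "(\<lambda>n. ennreal (max 0 (1 - real n * infdist x C))) \<longlonglongrightarrow> indicator C x"
        proof (cases "x \<in> C")
          case True
          then show ?thesis by simp
        next
          case False
          then have pos: "infdist x C > 0"
            using C in_closed_iff_infdist_zero[of C x] infdist_nonneg[of x C] by force
          obtain n0 :: nat where n0: "1 / infdist x C < real n0" using reals_Archimedean2 by blast
          have "eventually (\<lambda>n. ennreal (max 0 (1 - real n * infdist x C)) = 0) sequentially"
          proof (rule eventually_sequentiallyI[of n0])
            fix n assume "n0 \<le> n"
            then have "1 / infdist x C < real n" using n0 by (meson le_less_trans less_le_trans of_nat_le_iff)
            then have "1 \<le> real n * infdist x C" using pos by (simp add: field_simps)
            then show "ennreal (max 0 (1 - real n * infdist x C)) = 0" by simp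
          qed
          then show ?thesis using False by (simp add: tendsto_eventually)
        qed
      qed
    qed auto
    then show ?thesis by simp
  qed
  have univ: "emeasure M UNIV = emeasure N UNIV"
    using eq[of "\<lambda>_. 1"] sets_eq_imp_space_eq[OF sets(1)] sets_eq_imp_space_eq[OF sets(2)] by simp
  show ?thesis
  proof (rule measure_eqI_generator_eq[where E = "Collect closed" and \<Omega> = UNIV and A = "\<lambda>_. UNIV"])
    show "Int_stable (Collect closed)" by (auto simp: Int_stable_def)
    show "emeasure M C = emeasure N C" if "C \<in> Collect closed" for C
    proof (cases "C = {}")
      case False
      have "(\<lambda>n. \<integral>\<^sup>+x. ennreal (max 0 (1 - real n * infdist x C)) \<partial>M) =
        (\<lambda>n. \<integral>\<^sup>+x. ennreal (max 0 (1 - real n * infdist x C)) \<partial>N)"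
        by (intro ext eq) (auto intro!: continuous_intros simp: infdist_nonneg)
      moreover have "emeasure N UNIV \<noteq> \<infinity>"
        using univ M.emeasure_finite[of UNIV] by simp
      ultimately show ?thesis
        using lim[of C M] lim[of C N] that False sets M.emeasure_finite
        by (auto intro: LIMSEQ_unique)
    qed simp
    show "sets M = sigma_sets UNIV (Collect closed)" "sets N = sigma_sets UNIV (Collect closed)"
      using sets by (simp_all add: borel_eq_closed)
  qed auto
qed

lemma space_state_algebra: "space (state_algebra W :: ('e::topological_space \<times> 'u) measure) = UNIV \<times> W"
  by (simp add: state_algebra_def space_pair_measure)

lemma section_measurable_state_algebra:
  assumes "u \<in> W" "sets N = sets (restrict_space borel K)"
  shows "(\<lambda>x::'e::topological_space. (x, u)) \<in> N \<rightarrow>\<^sub>M state_algebra W"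
proof -
  have "(\<lambda>x::'e. (x, u)) \<in> borel \<rightarrow>\<^sub>M state_algebra W"
    unfolding state_algebra_def using assms(1) by (intro measurable_Pair2') simp
  then show ?thesis
    using measurable_restrict_space1 by (simp add: measurable_cong_sets[OF assms(2) refl])
qed

lemma rectangle_in_state_algebra:
  assumes "B \<in> sets borel" "u \<in> W"
  shows "B \<times> {u} \<in> sets (state_algebra W)"
  unfolding state_algebra_def using assms by (intro pair_measureI) auto

text \<open>
  \<open>finite_borel_measure_eqI\<close> on each of the finitely many slices \<open>E \<times> {u}\<close>. The test functions
  \<open>h x * of_bool (v = u)\<close> are those that can be inserted into the constraint.
\<close>

lemma finite_state_measure_eqI:
  fixes M N :: "('e::metric_space \<times> 'u) measure"
  assumes W: "finite W" and fin: "finite_measure M" "finite_measure N"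
    and sets: "sets M = sets (state_algebra W)" "sets N = sets (state_algebra W)"
    and eq: "\<And>h u. continuous_on UNIV h \<Longrightarrow> (\<And>x::'e. 0 \<le> h x \<and> h x \<le> 1) \<Longrightarrow> u \<in> W \<Longrightarrow>
      (\<integral>\<^sup>+s. ennreal (h (fst s) * of_bool (snd s = u)) \<partial>M) = (\<integral>\<^sup>+s. ennreal (h (fst s) * of_bool (snd s = u)) \<partial>N)"
  shows "M = N"
proof -
  have space: "space (state_algebra W :: ('e \<times> 'u) measure) = UNIV \<times> W"
    by (simp add: state_algebra_def space_pair_measure)
  \<comment> \<open>the restriction of \<open>L\<close> to \<open>E \<times> {u}\<close>, viewed as a measure on \<open>E\<close>\<close>
  define slice where "slice L u = distr (density L (\<lambda>s. of_bool (snd s = u))) borel fst" for L :: "('e \<times> 'u) measure" and u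
  have slice: "(\<integral>\<^sup>+x. f x \<partial>slice L u) = (\<integral>\<^sup>+s. f (fst s) * of_bool (snd s = u) \<partial>L)"
    if L: "sets L = sets (state_algebra W)" and u: "u \<in> W" and f[measurable]: "f \<in> borel_measurable borel" for L f u
  proof -
    have [measurable_cong]: "sets L = sets (borel \<Otimes>\<^sub>M count_space W)"
      using L by (simp add: state_algebra_def)
    have [measurable]: "(\<lambda>s. of_bool (snd s = u) :: ennreal) \<in> borel_measurable (borel \<Otimes>\<^sub>M count_space W)"
      using measurable_compose[OF measurable_snd, of "\<lambda>v. of_bool (v = u)"] by simp
    show ?thesis
      unfolding slice_def by (simp add: nn_integral_distr nn_integral_density mult.commute)
  qed
  have slices: "slice M u = slice N u" if u: "u \<in> W" for u
  proof (rule finite_borel_measure_eqI)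
    show "finite_measure (slice M u)"
    proof (rule finite_measureI)
      have "emeasure (slice M u) (space (slice M u)) = (\<integral>\<^sup>+x. 1 \<partial>slice M u)" by simp
      also have "\<dots> = (\<integral>\<^sup>+s. 1 * of_bool (snd s = u) \<partial>M)" by (rule slice[OF sets(1) u]) simp
      also have "\<dots> \<le> (\<integral>\<^sup>+s. 1 \<partial>M)" by (intro nn_integral_mono) auto
      also have "\<dots> < \<infinity>" using finite_measure.finite_emeasure_space[OF fin(1)] by (simp add: less_top)
      finally show "emeasure (slice M u) (space (slice M u)) \<noteq> \<infinity>" by simp
    qed
    fix h :: "'e \<Rightarrow> real" assume h: "continuous_on UNIV h" "\<And>x. 0 \<le> h x \<and> h x \<le> 1"
    have [measurable]: "h \<in> borel_measurable borel" using h(1) by (rule borel_measurable_continuous_onI)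
    have "ennreal (h (fst s)) * of_bool (snd s = u) = ennreal (h (fst s) * of_bool (snd s = u))" for s
      by simp
    then show "(\<integral>\<^sup>+x. ennreal (h x) \<partial>slice M u) = (\<integral>\<^sup>+x. ennreal (h x) \<partial>slice N u)"
      using eq[OF h u] by (simp add: slice sets u)
  qed (simp_all add: slice_def)
  have decomp: "emeasure L C = (\<Sum>u\<in>W. \<integral>\<^sup>+x. indicator {x. (x, u) \<in> C} x \<partial>slice L u)"
    if L: "sets L = sets (state_algebra W)" and C: "C \<in> sets (state_algebra W)" for L C
  proof -
    have CL: "C \<in> sets L" using L C by simp
    have [measurable_cong]: "sets L = sets (borel \<Otimes>\<^sub>M count_space W)"
      using L by (simp add: state_algebra_def)
    have [measurable]: "(\<lambda>s. of_bool (snd s = u) :: ennreal) \<in> borel_measurable (borel \<Otimes>\<^sub>M count_space W)" for u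
      using measurable_compose[OF measurable_snd, of "\<lambda>v. of_bool (v = u)"] by simp
    have sec: "{x. (x, u) \<in> C} \<in> sets borel" if "u \<in> W" for u
    proof -
      have "(\<lambda>x. (x, u)) \<in> (borel :: 'e measure) \<rightarrow>\<^sub>M state_algebra W"
        using that unfolding state_algebra_def by (intro measurable_Pair2') simp
      from measurable_sets[OF this C] show ?thesis by (simp add: vimage_def)
    qed
    have "emeasure L C = (\<integral>\<^sup>+s. indicator C s \<partial>L)" using CL by simp
    also have "\<dots> = (\<integral>\<^sup>+s. (\<Sum>u\<in>W. indicator C s * of_bool (snd s = u)) \<partial>L)"
    proof (rule nn_integral_cong)
      fix s assume "s \<in> space L"
      then have "snd s \<in> W" using space sets_eq_imp_space_eq[OF L] by auto
      then show "indicator C s = (\<Sum>u\<in>W. indicator C s * of_bool (snd s = u) :: ennreal)"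
        using W by (simp add: of_bool_def if_distrib sum.delta cong: if_cong)
    qed
    also have "\<dots> = (\<Sum>u\<in>W. \<integral>\<^sup>+s. indicator C s * of_bool (snd s = u) \<partial>L)"
    proof (intro nn_integral_sum borel_measurable_times_ennreal borel_measurable_indicator CL)
      show "(\<lambda>s. of_bool (snd s = u) :: ennreal) \<in> borel_measurable L" for u
        by measurable
    qed
    also have "\<dots> = (\<Sum>u\<in>W. \<integral>\<^sup>+x. indicator {x. (x, u) \<in> C} x \<partial>slice L u)"
      by (intro sum.cong refl, subst slice[OF L])
        (auto intro!: nn_integral_cong borel_measurable_indicator sec simp: indicator_def)
    finally show ?thesis .
  qed
  show ?thesis
    by (rule measure_eqI) (simp_all add: sets decomp slices cong: sum.cong)
qed

section \<open>A Markov chain with independent uniform marks\<close>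

text \<open>
  The uniform law on the unit interval, kept opaque so that the simplifier does not expand it inside
  iterated integrals.
\<close>

definition mark_law :: "real measure" where
  "mark_law = uniform_measure lborel {0..1}"

lemma sets_mark_law [measurable_cong, simp]: "sets mark_law = sets borel"
  by (simp add: mark_law_def)

lemma space_mark_law [simp]: "space mark_law = UNIV"
  by (simp add: mark_law_def)

lemma prob_space_mark_law: "prob_space mark_law"
  unfolding mark_law_def by (rule prob_space_uniform_measure) auto

lemma emeasure_mark_law_below:
  assumes "0 \<le> a" "a \<le> 1"
  shows "emeasure mark_law {0..<a} = ennreal a"
proof -
  have "{0..1} \<inter> {0..<a} = {0..<a}" using assms by auto
  then show ?thesis using assms by (simp add: mark_law_def emeasure_uniform_measure divide_ennreal_def)
qed

text \<open>
  A Markov chain on \<open>A \<Otimes>\<^sub>M B\<close> with initial law \<open>\<nu>\<close>, with kernel \<open>K t\<close> from time \<open>t - 1\<close> to time \<open>t\<close>,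
  and with the probability \<open>a t s\<close> of surviving time \<open>t\<close> in state \<open>s\<close>.
\<close>

locale killed_chain =
  fixes A :: "'x measure" and B :: "'u measure"
    and \<nu> :: "('x \<times> 'u) measure"
    and K :: "nat \<Rightarrow> 'x \<times> 'u \<Rightarrow> ('x \<times> 'u) measure"
    and a :: "nat \<Rightarrow> 'x \<times> 'u \<Rightarrow> real"
  assumes initial: "\<nu> \<in> space (prob_algebra (A \<Otimes>\<^sub>M B))"
    and kernel: "\<And>t. K t \<in> A \<Otimes>\<^sub>M B \<rightarrow>\<^sub>M prob_algebra (A \<Otimes>\<^sub>M B)"
    and survival [measurable]: "\<And>t. a t \<in> borel_measurable (A \<Otimes>\<^sub>M B)"
    and survival_bounds: "\<And>t s. 0 \<le> a t s" "\<And>t s. a t s \<le> 1"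
begin

definition points :: "('x \<times> 'u \<times> real) measure" where
  "points = A \<Otimes>\<^sub>M (B \<Otimes>\<^sub>M borel)"

definition state :: "'x \<times> 'u \<times> real \<Rightarrow> 'x \<times> 'u" where
  "state = (\<lambda>(x, u, r). (x, u))"

definition mark :: "'x \<times> 'u \<times> real \<Rightarrow> real" where
  "mark = (\<lambda>(x, u, r). r)"

definition attach_mark :: "('x \<times> 'u) measure \<Rightarrow> ('x \<times> 'u \<times> real) measure" where
  "attach_mark N = distr (N \<Otimes>\<^sub>M mark_law) points (\<lambda>(s, r). (fst s, snd s, r))"

text \<open>
  The conditional law of the state at time \<open>n\<close> given the path before \<open>n\<close>. It reads only the state,
  not the mark, of the last point of the path; this is what preserves the Markov property.
\<close>

definition next_state :: "nat \<Rightarrow> (nat \<Rightarrow> 'x \<times> 'u \<times> real) \<Rightarrow> ('x \<times> 'u) measure" where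
  "next_state n \<omega> = (case n of 0 \<Rightarrow> \<nu> | Suc k \<Rightarrow> K n (state (\<omega> k)))"

lemma state_measurable [measurable]: "state \<in> points \<rightarrow>\<^sub>M A \<Otimes>\<^sub>M B"
  unfolding state_def points_def by measurable

lemma mark_measurable [measurable]: "mark \<in> borel_measurable points"
  unfolding mark_def points_def by measurable

lemma kernel_subprob [measurable]: "K t \<in> A \<Otimes>\<^sub>M B \<rightarrow>\<^sub>M subprob_algebra (A \<Otimes>\<^sub>M B)"
  using kernel by (rule measurable_prob_algebraD)

lemma next_state_measurable: "next_state n \<in> PiM {0..<n} (\<lambda>_. points) \<rightarrow>\<^sub>M prob_algebra (A \<Otimes>\<^sub>M B)"
proof (cases n)
  case 0
  then show ?thesis using initial by (simp add: next_state_def[abs_def])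
next
  case (Suc k)
  have "(\<lambda>\<omega>. K (Suc k) (state (\<omega> k))) \<in> PiM {0..<Suc k} (\<lambda>_. points) \<rightarrow>\<^sub>M prob_algebra (A \<Otimes>\<^sub>M B)"
    by (rule measurable_compose[OF _ kernel]) measurable
  then show ?thesis by (simp add: Suc next_state_def[abs_def])
qed

lemma mark_law_subprob: "mark_law \<in> space (subprob_algebra borel)"
  using prob_space_imp_subprob_space[OF prob_space_mark_law]
  by (simp add: space_subprob_algebra)

lemma attach_mark_measurable: "attach_mark \<in> subprob_algebra (A \<Otimes>\<^sub>M B) \<rightarrow>\<^sub>M subprob_algebra points"
  unfolding attach_mark_def
proof (rule measurable_compose[OF _ measurable_distr])
  show "(\<lambda>N. N \<Otimes>\<^sub>M mark_law) \<in>
      subprob_algebra (A \<Otimes>\<^sub>M B) \<rightarrow>\<^sub>M subprob_algebra ((A \<Otimes>\<^sub>M B) \<Otimes>\<^sub>M borel)"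
    by (intro measurable_pair_measure measurable_const mark_law_subprob) simp
  show "(\<lambda>(s, r). (fst s, snd s, r)) \<in> (A \<Otimes>\<^sub>M B) \<Otimes>\<^sub>M borel \<rightarrow>\<^sub>M points"
    unfolding points_def by measurable
qed

lemma nn_integral_attach_mark:
  assumes N: "N \<in> space (subprob_algebra (A \<Otimes>\<^sub>M B))" and [measurable]: "f \<in> borel_measurable points"
  shows "(\<integral>\<^sup>+y. f y \<partial>attach_mark N) =
    (\<integral>\<^sup>+s. \<integral>\<^sup>+r. f (fst s, snd s, r) \<partial>mark_law \<partial>N)"
proof -
  have [measurable_cong]: "sets N = sets (A \<Otimes>\<^sub>M B)"
    using N by (simp add: space_subprob_algebra)
  interpret U: prob_space "mark_law"
    by (rule prob_space_mark_law)
  have [measurable]: "(\<lambda>(s, r). (fst s, snd s, r)) \<in> N \<Otimes>\<^sub>M mark_law \<rightarrow>\<^sub>M points"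
    unfolding points_def by measurable
  have f [measurable]: "(\<lambda>p. f (fst (fst p), snd (fst p), snd p)) \<in> borel_measurable (N \<Otimes>\<^sub>M mark_law)"
    using measurable_compose[OF _ assms(2), of "\<lambda>(s, r). (fst s, snd s, r)" "N \<Otimes>\<^sub>M mark_law"]
    by (simp add: case_prod_beta')
  have "(\<integral>\<^sup>+y. f y \<partial>attach_mark N) =
      (\<integral>\<^sup>+p. f (fst (fst p), snd (fst p), snd p) \<partial>(N \<Otimes>\<^sub>M mark_law))"
    unfolding attach_mark_def by (subst nn_integral_distr) (auto simp: case_prod_beta)
  also have "\<dots> = (\<integral>\<^sup>+s. \<integral>\<^sup>+r. f (fst s, snd s, r) \<partial>mark_law \<partial>N)"
    using U.nn_integral_fst[OF f] by simp
  finally show ?thesis .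
qed

lemma prob_space_attach_mark:
  assumes "N \<in> space (prob_algebra (A \<Otimes>\<^sub>M B))"
  shows "prob_space (attach_mark N)"
proof -
  have N: "prob_space N" and sets: "sets N = sets (A \<Otimes>\<^sub>M B)"
    using assms by (auto simp: space_prob_algebra)
  note [measurable_cong] = sets
  interpret N: prob_space N by fact
  interpret U: prob_space "mark_law"
    by (rule prob_space_mark_law)
  interpret pair_prob_space N "mark_law" ..
  show ?thesis
    unfolding attach_mark_def points_def by (intro P.prob_space_distr) measurable
qed

sublocale paths: Ionescu_Tulcea "\<lambda>n \<omega>. attach_mark (next_state n \<omega>)" "\<lambda>_. points"
proof (rule Ionescu_Tulcea.intro, goal_cases)
  case (1 n)
  show ?case
    by (rule measurable_compose[OF measurable_prob_algebraD[OF next_state_measurable] attach_mark_measurable])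
next
  case (2 n \<omega>)
  show ?case
    by (rule prob_space_attach_mark[OF measurable_space[OF next_state_measurable 2]])
qed

abbreviation path_space :: "nat \<Rightarrow> (nat \<Rightarrow> 'x \<times> 'u \<times> real) measure" where
  "path_space n \<equiv> PiM {0..<n} (\<lambda>_. points)"

text \<open>The law of the marked path at the times \<open>0, \<dots>, n - 1\<close>.\<close>

definition path_law :: "nat \<Rightarrow> (nat \<Rightarrow> 'x \<times> 'u \<times> real) measure" where
  "path_law n = paths.C 0 n (\<lambda>_. undefined)"

lemma undefined_in_path_space: "(\<lambda>_. undefined) \<in> space (path_space 0)"
  by (simp add: space_PiM)

lemma sets_path_law [measurable_cong, simp]: "sets (path_law n) = sets (path_space n)"
  unfolding path_law_def using paths.sets_C[OF undefined_in_path_space, of n] by simp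

lemma space_path_law: "space (path_law n) = space (path_space n)"
  by (rule sets_eq_imp_space_eq) simp

lemma prob_space_path_law: "prob_space (path_law n)"
  unfolding path_law_def by (rule paths.prob_space_C[OF undefined_in_path_space])

lemma nn_integral_path_law_Suc:
  assumes f [measurable]: "f \<in> borel_measurable (path_space (Suc n))"
  shows "(\<integral>\<^sup>+\<omega>. f \<omega> \<partial>path_law (Suc n)) =
    (\<integral>\<^sup>+\<omega>. \<integral>\<^sup>+s. \<integral>\<^sup>+r. f (fun_upd \<omega> n (fst s, snd s, r)) \<partial>mark_law \<partial>next_state n \<omega> \<partial>path_law n)"
proof -
  have "path_law (Suc n) = path_law n \<bind> paths.eP n"
    by (simp add: path_law_def)
  then have "(\<integral>\<^sup>+\<omega>. f \<omega> \<partial>path_law (Suc n)) = (\<integral>\<^sup>+\<omega>. \<integral>\<^sup>+\<omega>'. f \<omega>' \<partial>paths.eP n \<omega> \<partial>path_law n)"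
    by (simp add: nn_integral_bind[where B = "path_space (Suc n)"])
  also have "\<dots> = (\<integral>\<^sup>+\<omega>. \<integral>\<^sup>+s. \<integral>\<^sup>+r. f (fun_upd \<omega> n (fst s, snd s, r)) \<partial>mark_law \<partial>next_state n \<omega> \<partial>path_law n)"
  proof (rule nn_integral_cong)
    fix \<omega> assume "\<omega> \<in> space (path_law n)"
    then have \<omega>: "\<omega> \<in> space (path_space n)" by (simp add: space_path_law)
    have [measurable]: "(\<lambda>y. fun_upd \<omega> n y) \<in> points \<rightarrow>\<^sub>M path_space (Suc n)"
      using \<omega> by (intro measurable_fun_upd[where J = "{0..<n}"]) auto
    have "next_state n \<omega> \<in> space (subprob_algebra (A \<Otimes>\<^sub>M B))"
      by (rule measurable_space[OF measurable_prob_algebraD[OF next_state_measurable] \<omega>])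
    then show "(\<integral>\<^sup>+\<omega>'. f \<omega>' \<partial>paths.eP n \<omega>) =
        (\<integral>\<^sup>+s. \<integral>\<^sup>+r. f (fun_upd \<omega> n (fst s, snd s, r)) \<partial>mark_law \<partial>next_state n \<omega>)"
      using \<omega> by (simp add: paths.nn_integral_eP nn_integral_attach_mark)
  qed
  finally show ?thesis .
qed

lemma nn_integral_path_law_restrict:
  assumes "n \<le> n'" "f \<in> borel_measurable (path_space n)"
  shows "(\<integral>\<^sup>+\<omega>. f (restrict \<omega> {0..<n}) \<partial>path_law n') = (\<integral>\<^sup>+\<omega>. f \<omega> \<partial>path_law n)"
  unfolding path_law_def
  using paths.nn_integral_C[of n n' f 0 "\<lambda>_. undefined"] assms undefined_in_path_space by simp

definition survives :: "nat \<Rightarrow> 'x \<times> 'u \<times> real \<Rightarrow> bool" where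
  "survives t y \<longleftrightarrow> 0 \<le> mark y \<and> mark y < a t (state y)"

lemma survives_measurable [measurable]: "Measurable.pred points (survives t)"
  unfolding survives_def[abs_def] by measurable

text \<open>
  The mass that reaches time \<open>n\<close>: multiplying by \<open>a n\<close> removes what is killed at time \<open>n\<close>, and the
  next kernel transports the rest.
\<close>

primrec arrival :: "nat \<Rightarrow> ('x \<times> 'u) measure" where
  "arrival 0 = \<nu>"
| "arrival (Suc n) = density (arrival n) (\<lambda>s. ennreal (a n s)) \<bind> K (Suc n)"

lemma space_states_not_empty: "space (A \<Otimes>\<^sub>M B) \<noteq> {}"
proof -
  interpret prob_space \<nu> using initial by (simp add: space_prob_algebra)
  show ?thesis
    using not_empty sets_eq_imp_space_eq[of \<nu> "A \<Otimes>\<^sub>M B"] initial by (simp add: space_prob_algebra)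
qed

lemma sets_arrival [measurable_cong, simp]: "sets (arrival n) = sets (A \<Otimes>\<^sub>M B)"
proof (induction n)
  case 0
  then show ?case using initial by (simp add: space_prob_algebra)
next
  case (Suc n)
  have sp: "space (arrival n) = space (A \<Otimes>\<^sub>M B)" by (rule sets_eq_imp_space_eq[OF Suc])
  show ?case
    unfolding arrival.simps
    by (rule sets_bind) (simp_all only: sp space_states_not_empty sets_kernel[OF kernel_subprob] space_density not_False_eq_True)
qed

text \<open>Survival strictly before \<open>n\<close>; survival of time \<open>n\<close> itself is \<open>alive (Suc n)\<close>.\<close>

definition alive :: "nat \<Rightarrow> (nat \<Rightarrow> 'x \<times> 'u \<times> real) \<Rightarrow> bool" where
  "alive n \<omega> \<longleftrightarrow> (\<forall>s<n. survives s (\<omega> s))"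

lemma alive_measurable:
  assumes "n \<le> n'"
  shows "Measurable.pred (path_space n') (alive n)"
proof -
  have "Measurable.pred (path_space n') (\<lambda>\<omega>. survives s (\<omega> s))" if "s \<in> {..<n}" for s
  proof -
    have "(\<lambda>\<omega>. \<omega> s) \<in> path_space n' \<rightarrow>\<^sub>M points"
      using assms that by (intro measurable_component_singleton) auto
    then show ?thesis by measurable
  qed
  then have "Measurable.pred (path_space n') (\<lambda>\<omega>. \<forall>s\<in>{..<n}. survives s (\<omega> s))"
    by (intro pred_intros_finite) auto
  moreover have "(\<lambda>\<omega>. \<forall>s\<in>{..<n}. survives s (\<omega> s)) = alive n"
    by (auto simp: alive_def fun_eq_iff)
  ultimately show ?thesis by simp
qed

text \<open>
  The common source of the two laws of the killed chain and of the Markov property: conditioning on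
  the past pulls out the factor \<open>h\<close> that depends on the path before \<open>n\<close> only, and what remains is an
  integral over the new state and its independent mark.
\<close>

lemma nn_integral_path_law_product:
  assumes h [measurable]: "h \<in> borel_measurable (path_space n)"
    and F [measurable]: "F \<in> borel_measurable points"
  shows "(\<integral>\<^sup>+\<omega>. h (restrict \<omega> {0..<n}) * F (\<omega> n) \<partial>path_law (Suc n)) =
    (\<integral>\<^sup>+\<omega>. h \<omega> * (\<integral>\<^sup>+s. \<integral>\<^sup>+r. F (fst s, snd s, r) \<partial>mark_law \<partial>next_state n \<omega>) \<partial>path_law n)"
proof -
  have [measurable]: "(\<lambda>\<omega>. restrict \<omega> {0..<n}) \<in> path_space (Suc n) \<rightarrow>\<^sub>M path_space n"
    by (rule measurable_restrict_subset) auto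
  have "(\<integral>\<^sup>+\<omega>. h (restrict \<omega> {0..<n}) * F (\<omega> n) \<partial>path_law (Suc n)) =
    (\<integral>\<^sup>+\<omega>. \<integral>\<^sup>+s. \<integral>\<^sup>+r. h (restrict (fun_upd \<omega> n (fst s, snd s, r)) {0..<n}) * F ((fun_upd \<omega> n (fst s, snd s, r)) n)
      \<partial>mark_law \<partial>next_state n \<omega> \<partial>path_law n)"
    by (rule nn_integral_path_law_Suc) measurable
  also have "\<dots> = (\<integral>\<^sup>+\<omega>. h \<omega> * (\<integral>\<^sup>+s. \<integral>\<^sup>+r. F (fst s, snd s, r) \<partial>mark_law \<partial>next_state n \<omega>) \<partial>path_law n)"
  proof (rule nn_integral_cong)
    fix \<omega> assume "\<omega> \<in> space (path_law n)"
    then have \<omega>: "\<omega> \<in> space (path_space n)" by (simp add: space_path_law)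
    then have "restrict (fun_upd \<omega> n y) {0..<n} = \<omega>" for y
      by (auto simp: space_PiM fun_eq_iff PiE_iff extensional_def)
    moreover have [measurable_cong]: "sets (next_state n \<omega>) = sets (A \<Otimes>\<^sub>M B)"
      using measurable_space[OF next_state_measurable \<omega>] by (simp add: space_prob_algebra)
    have [measurable]: "(\<lambda>(s, r). F (fst s, snd s, r)) \<in> borel_measurable ((A \<Otimes>\<^sub>M B) \<Otimes>\<^sub>M mark_law)"
      using measurable_compose[OF _ F, of "\<lambda>(s, r). (fst s, snd s, r)" "(A \<Otimes>\<^sub>M B) \<Otimes>\<^sub>M mark_law"]
      by (simp add: case_prod_beta' points_def)
    interpret prob_space mark_law by (rule prob_space_mark_law)
    have [measurable]: "(\<lambda>s. \<integral>\<^sup>+r. F (fst s, snd s, r) \<partial>mark_law) \<in> borel_measurable (A \<Otimes>\<^sub>M B)"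
      by measurable
    have sec: "(\<lambda>r. F (fst s, snd s, r)) \<in> borel_measurable mark_law" if "s \<in> space (next_state n \<omega>)" for s
      using that sets_eq_imp_space_eq[OF \<open>sets (next_state n \<omega>) = sets (A \<Otimes>\<^sub>M B)\<close>]
      by (intro measurable_compose[OF _ F]) (auto simp: points_def space_pair_measure)
    ultimately show "(\<integral>\<^sup>+s. \<integral>\<^sup>+r. h (restrict (fun_upd \<omega> n (fst s, snd s, r)) {0..<n}) * F ((fun_upd \<omega> n (fst s, snd s, r)) n)
        \<partial>mark_law \<partial>next_state n \<omega>) = h \<omega> * (\<integral>\<^sup>+s. \<integral>\<^sup>+r. F (fst s, snd s, r) \<partial>mark_law \<partial>next_state n \<omega>)"
      by (simp add: nn_integral_cmult sec cong: nn_integral_cong)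
  qed
  finally show ?thesis .
qed

lemma nn_integral_mark_law_state:
  "(\<integral>\<^sup>+r. f (state (fst s, snd s, r)) \<partial>mark_law) = f s"
  using prob_space.emeasure_space_1[OF prob_space_mark_law] by (simp add: state_def)

text \<open>A uniform mark falls below \<open>a t s\<close> with probability \<open>a t s\<close>.\<close>

lemma nn_integral_mark_law_survives:
  "(\<integral>\<^sup>+r. f (state (fst s, snd s, r)) * indicator {y. survives t y} (fst s, snd s, r) \<partial>mark_law) = f s * ennreal (a t s)"
proof -
  have "(\<integral>\<^sup>+r. f (state (fst s, snd s, r)) * indicator {y. survives t y} (fst s, snd s, r) \<partial>mark_law) =
      (\<integral>\<^sup>+r. f s * indicator {0..<a t s} r \<partial>mark_law)"
    by (intro nn_integral_cong) (auto simp: state_def mark_def survives_def indicator_def)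
  then show ?thesis
    using survival_bounds by (simp add: nn_integral_cmult_indicator emeasure_mark_law_below)
qed

text \<open>
  The key induction. Integrating out the mark of time \<open>n\<close> replaces survival of \<open>n\<close> by the factor
  \<open>a n\<close> (\<open>survive\<close>), and integrating out the state of time \<open>n + 1\<close> applies the kernel (\<open>arrive\<close>);
  these are the two operations in the recursion for \<open>arrival\<close>.
\<close>

lemma
  assumes f [measurable]: "f \<in> borel_measurable (A \<Otimes>\<^sub>M B)"
  shows nn_integral_arrival:
    "(\<integral>\<^sup>+\<omega>. indicator (Collect (alive n)) \<omega> * f (state (\<omega> n)) \<partial>path_law (Suc n)) = (\<integral>\<^sup>+s. f s \<partial>arrival n)"
    and nn_integral_survival:
    "(\<integral>\<^sup>+\<omega>. indicator (Collect (alive (Suc n))) \<omega> * f (state (\<omega> n)) \<partial>path_law (Suc n)) =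
      (\<integral>\<^sup>+s. f s \<partial>density (arrival n) (\<lambda>s. ennreal (a n s)))"
proof -
  have alive_restrict: "indicator (Collect (alive n)) (restrict \<omega> {0..<n}) = (indicator (Collect (alive n)) \<omega> :: ennreal)" for n \<omega>
    by (auto simp: alive_def indicator_def)
  have alive_Suc: "indicator (Collect (alive (Suc n))) \<omega> =
      (indicator (Collect (alive n)) \<omega> * indicator {y. survives n y} (\<omega> n) :: ennreal)" for n \<omega>
    by (auto simp: alive_def less_Suc_eq indicator_def)
  have [measurable]: "Measurable.pred (path_space n) (alive n)" for n
    by (rule alive_measurable) simp
  have arrive: "(\<integral>\<^sup>+\<omega>. indicator (Collect (alive n)) \<omega> * f (state (\<omega> n)) \<partial>path_law (Suc n)) =
      (\<integral>\<^sup>+\<omega>. indicator (Collect (alive n)) \<omega> * (\<integral>\<^sup>+s. f s \<partial>next_state n \<omega>) \<partial>path_law n)"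
    if [measurable]: "f \<in> borel_measurable (A \<Otimes>\<^sub>M B)" for f n
    using nn_integral_path_law_product[of "indicator (Collect (alive n))" n "\<lambda>y. f (state y)"]
    by (simp add: alive_restrict nn_integral_mark_law_state)
  have survive: "(\<integral>\<^sup>+\<omega>. indicator (Collect (alive (Suc n))) \<omega> * f (state (\<omega> n)) \<partial>path_law (Suc n)) =
      (\<integral>\<^sup>+\<omega>. indicator (Collect (alive n)) \<omega> * (f (state (\<omega> n)) * ennreal (a n (state (\<omega> n)))) \<partial>path_law (Suc n))"
    if [measurable]: "f \<in> borel_measurable (A \<Otimes>\<^sub>M B)" for f n
  proof -
    have "(\<integral>\<^sup>+\<omega>. indicator (Collect (alive (Suc n))) \<omega> * f (state (\<omega> n)) \<partial>path_law (Suc n)) =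
        (\<integral>\<^sup>+\<omega>. indicator (Collect (alive n)) \<omega> * (\<integral>\<^sup>+s. f s * ennreal (a n s) \<partial>next_state n \<omega>) \<partial>path_law n)"
      using nn_integral_path_law_product[of "indicator (Collect (alive n))" n "\<lambda>y. f (state y) * indicator {y. survives n y} y"]
      by (simp add: alive_restrict nn_integral_mark_law_survives alive_Suc mult_ac)
    also have "\<dots> = (\<integral>\<^sup>+\<omega>. indicator (Collect (alive n)) \<omega> * (f (state (\<omega> n)) * ennreal (a n (state (\<omega> n)))) \<partial>path_law (Suc n))"
      using arrive[of "\<lambda>s. f s * ennreal (a n s)" n] by simp
    finally show ?thesis .
  qed
  have arr: "(\<integral>\<^sup>+\<omega>. indicator (Collect (alive n)) \<omega> * f (state (\<omega> n)) \<partial>path_law (Suc n)) = (\<integral>\<^sup>+s. f s \<partial>arrival n)"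
    if "f \<in> borel_measurable (A \<Otimes>\<^sub>M B)" for f n
    using that
  proof (induction n arbitrary: f)
    case 0
    then show ?case
      using arrive[OF 0, of 0] prob_space.emeasure_space_1[OF prob_space_path_law]
      by (simp add: next_state_def alive_def)
  next
    case (Suc n)
    note [measurable] = Suc.prems
    have [measurable]: "(\<lambda>s. \<integral>\<^sup>+s'. f s' \<partial>K (Suc n) s) \<in> borel_measurable (A \<Otimes>\<^sub>M B)"
      by (rule nn_integral_measurable_subprob_algebra2[OF _ kernel_subprob]) measurable
    have "(\<integral>\<^sup>+\<omega>. indicator (Collect (alive (Suc n))) \<omega> * f (state (\<omega> (Suc n))) \<partial>path_law (Suc (Suc n))) =
        (\<integral>\<^sup>+\<omega>. indicator (Collect (alive (Suc n))) \<omega> * (\<integral>\<^sup>+s. f s \<partial>K (Suc n) (state (\<omega> n))) \<partial>path_law (Suc n))"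
      using Suc.prems by (subst arrive) (simp_all add: next_state_def)
    also have "\<dots> = (\<integral>\<^sup>+\<omega>. indicator (Collect (alive n)) \<omega> *
        ((\<integral>\<^sup>+s. f s \<partial>K (Suc n) (state (\<omega> n))) * ennreal (a n (state (\<omega> n)))) \<partial>path_law (Suc n))"
      by (rule survive) measurable
    also have "\<dots> = (\<integral>\<^sup>+s. (\<integral>\<^sup>+s'. f s' \<partial>K (Suc n) s) * ennreal (a n s) \<partial>arrival n)"
      by (rule Suc.IH) measurable
    also have "\<dots> = (\<integral>\<^sup>+s. \<integral>\<^sup>+s'. f s' \<partial>K (Suc n) s \<partial>density (arrival n) (\<lambda>s. ennreal (a n s)))"
      by (subst nn_integral_density) (simp_all add: mult.commute)
    also have "\<dots> = (\<integral>\<^sup>+s. f s \<partial>arrival (Suc n))"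
      unfolding arrival.simps by (rule nn_integral_bind[symmetric, where B = "A \<Otimes>\<^sub>M B"]) measurable
    finally show ?case .
  qed
  show "(\<integral>\<^sup>+\<omega>. indicator (Collect (alive n)) \<omega> * f (state (\<omega> n)) \<partial>path_law (Suc n)) = (\<integral>\<^sup>+s. f s \<partial>arrival n)"
    by (rule arr) fact
  show "(\<integral>\<^sup>+\<omega>. indicator (Collect (alive (Suc n))) \<omega> * f (state (\<omega> n)) \<partial>path_law (Suc n)) =
      (\<integral>\<^sup>+s. f s \<partial>density (arrival n) (\<lambda>s. ennreal (a n s)))"
    using survive[OF f, of n] arr[of "\<lambda>s. f s * ennreal (a n s)" n]
    by (subst nn_integral_density) (simp_all add: mult.commute)
qed

text \<open>
  The events determined by states and marks up to and including time \<open>t\<close>, on the space of paths with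
  time horizon \<open>T\<close>.
\<close>

definition history :: "nat \<Rightarrow> nat \<Rightarrow> (nat \<Rightarrow> 'x \<times> 'u \<times> real) measure" where
  "history T t = vimage_algebra (space (path_law (Suc T))) (\<lambda>\<omega>. restrict \<omega> {0..<Suc t}) (path_space (Suc t))"

lemma restrict_measurable:
  assumes "n \<le> n'"
  shows "(\<lambda>\<omega>. restrict \<omega> {0..<n}) \<in> path_space n' \<rightarrow>\<^sub>M path_space n"
  using assms by (intro measurable_restrict_subset) auto

lemma restrict_in_path_space:
  assumes "n \<le> n'" "\<omega> \<in> space (path_law n')"
  shows "restrict \<omega> {0..<n} \<in> space (path_space n)"
  using measurable_space[OF restrict_measurable[OF assms(1)]] assms(2) by (simp add: space_path_law)

lemma sets_history:
  assumes "t \<le> T"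
  shows "sets (history T t) =
    {(\<lambda>\<omega>. restrict \<omega> {0..<Suc t}) -` G \<inter> space (path_law (Suc T)) | G. G \<in> sets (path_space (Suc t))}"
  unfolding history_def
  by (rule sets_vimage_algebra2) (use assms in \<open>auto intro!: restrict_in_path_space[where n' = "Suc T"] simp del: restrict_apply\<close>)

lemma restrict_measurable_history:
  assumes "t \<le> T"
  shows "(\<lambda>\<omega>. restrict \<omega> {0..<Suc t}) \<in> history T t \<rightarrow>\<^sub>M path_space (Suc t)"
  unfolding history_def
  by (rule measurable_vimage_algebra1) (use assms in \<open>auto intro!: restrict_in_path_space[where n' = "Suc T"] simp del: restrict_apply\<close>)

lemma coordinate_measurable_history:
  assumes "s \<le> t" "t \<le> T"
  shows "(\<lambda>\<omega>. \<omega> s) \<in> history T t \<rightarrow>\<^sub>M points"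
proof -
  have "(\<lambda>\<omega>. restrict \<omega> {0..<Suc t} s) \<in> history T t \<rightarrow>\<^sub>M points"
    using assms by (intro measurable_compose[OF restrict_measurable_history measurable_component_singleton]) auto
  then show ?thesis using assms by simp
qed

lemma subalgebra_history:
  assumes "t \<le> T"
  shows "subalgebra (path_law (Suc T)) (history T t)"
  unfolding subalgebra_def
proof
  show "space (history T t) = space (path_law (Suc T))" by (simp add: history_def)
  have "(\<lambda>\<omega>. restrict \<omega> {0..<Suc t}) \<in> path_law (Suc T) \<rightarrow>\<^sub>M path_space (Suc t)"
    using restrict_measurable[of "Suc t" "Suc T"] assms by (simp cong: measurable_cong_sets)
  then show "sets (history T t) \<subseteq> sets (path_law (Suc T))"
    unfolding sets_history[OF assms] by (auto dest: measurable_sets)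
qed

lemma sets_history_mono:
  assumes "t \<le> t'" "t' \<le> T"
  shows "sets (history T t) \<subseteq> sets (history T t')"
proof -
  have "(\<lambda>\<omega>. restrict (restrict \<omega> {0..<Suc t'}) {0..<Suc t}) \<in> history T t' \<rightarrow>\<^sub>M path_space (Suc t)"
    by (rule measurable_compose[OF restrict_measurable_history restrict_measurable]) (use assms in auto)
  moreover have "{0..<Suc t'} \<inter> {0..<Suc t} = {0..<Suc t}" using assms by auto
  moreover have "space (history T t') = space (path_law (Suc T))" by (simp add: history_def)
  ultimately show ?thesis
    using assms sets_history[of t T] by (auto dest!: measurable_sets simp del: restrict_apply)
qed

text \<open>
  For \<open>G\<close> in the history of \<open>t\<close>, cut the paths at \<open>t + 1\<close> and integrate out the last point: the mark
  disappears and the state contributes its transition kernel, which depends on the state at \<open>t\<close>.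
\<close>

lemma markov_property:
  assumes t: "Suc t \<le> T" and C: "C \<in> sets (A \<Otimes>\<^sub>M B)"
  shows "AE \<omega> in completion (path_law (Suc T)).
    real_cond_exp (completion (path_law (Suc T))) (null_augmentation (path_law (Suc T)) (history T t))
      (\<lambda>\<omega>'. indicator C (state (\<omega>' (Suc t)))) \<omega>
    = measure (K (Suc t) (state (\<omega> t))) C"
proof (rule real_cond_exp_null_augmentation[OF prob_space_path_law subalgebra_history])
  note [measurable] = C
  interpret N: prob_space "path_law (Suc T)" by (rule prob_space_path_law)
  have coordinate: "(\<lambda>\<omega>. \<omega> s) \<in> path_space n \<rightarrow>\<^sub>M points" if "s < n" for s n
    using that by (intro measurable_component_singleton) auto
  have [measurable]: "(\<lambda>\<omega>. \<omega> (Suc t)) \<in> path_law (Suc T) \<rightarrow>\<^sub>M points" "(\<lambda>\<omega>. \<omega> t) \<in> path_law (Suc T) \<rightarrow>\<^sub>M points"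
    "(\<lambda>\<omega>. \<omega> (Suc t)) \<in> path_space (Suc (Suc t)) \<rightarrow>\<^sub>M points" "(\<lambda>\<omega>. \<omega> t) \<in> path_space (Suc t) \<rightarrow>\<^sub>M points"
    using t coordinate by (simp_all cong: measurable_cong_sets)
  have [measurable]: "(\<lambda>s. measure (K n s) C) \<in> borel_measurable (A \<Otimes>\<^sub>M B)" for n
    by (rule measurable_compose[OF kernel_subprob measurable_measure_subprob_algebra]) fact
  have [measurable]: "(\<lambda>s. emeasure (K n s) C) \<in> borel_measurable (A \<Otimes>\<^sub>M B)" for n
    by (rule measurable_compose[OF kernel_subprob measurable_emeasure_subprob_algebra]) fact
  have state_in: "state (\<omega> t) \<in> space (A \<Otimes>\<^sub>M B)" if "\<omega> \<in> space (path_law (Suc T))" for \<omega>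
    using that t by (intro measurable_space[OF state_measurable]) (auto simp: space_path_law space_PiM PiE_iff)
  have prob: "prob_space (K (Suc t) (state (\<omega> t)))" if "\<omega> \<in> space (path_law (Suc T))" for \<omega>
    using measurable_space[OF kernel state_in[OF that]] by (simp add: space_prob_algebra)
  have meas_C: "(\<lambda>\<omega>. indicator C (state (\<omega> (Suc t))) :: real) \<in> borel_measurable (path_law (Suc T))"
    by measurable
  have meas_K: "(\<lambda>\<omega>. measure (K (Suc t) (state (\<omega> t))) C) \<in> borel_measurable (path_law (Suc T))"
    by measurable
  show "t \<le> T" using t by simp
  show "(\<lambda>\<omega>. measure (K (Suc t) (state (\<omega> t))) C) \<in> borel_measurable (history T t)"
    using t by (intro measurable_compose[OF coordinate_measurable_history]) (auto intro!: measurable_compose[OF state_measurable])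
  show "integrable (path_law (Suc T)) (\<lambda>\<omega>. indicator C (state (\<omega> (Suc t))) :: real)"
    using meas_C by (intro N.integrable_const_bound[where B = 1]) simp_all
  show "integrable (path_law (Suc T)) (\<lambda>\<omega>. measure (K (Suc t) (state (\<omega> t))) C)"
    using meas_K by (intro N.integrable_const_bound[where B = 1] AE_I2) (auto intro: prob_space.prob_le_1[OF prob])
  fix G assume G: "G \<in> sets (history T t)"
  \<comment> \<open>\<open>G\<close> is a condition \<open>G'\<close> on the path up to \<open>t\<close>, so the product formula applies with \<open>h = indicator G'\<close>\<close>
  then obtain G' where [measurable]: "G' \<in> sets (path_space (Suc t))"
    and G': "G = (\<lambda>\<omega>. restrict \<omega> {0..<Suc t}) -` G' \<inter> space (path_law (Suc T))"
    using t by (auto simp: sets_history)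
  have [measurable]: "G \<in> sets (path_law (Suc T))"
    using G subalgebra_history[of t T] t by (auto simp: subalgebra_def)
  have "(\<integral>\<^sup>+\<omega>. indicator G \<omega> * indicator C (state (\<omega> (Suc t))) \<partial>path_law (Suc T)) =
      (\<integral>\<^sup>+\<omega>. indicator G' (restrict (restrict \<omega> {0..<Suc (Suc t)}) {0..<Suc t}) *
        indicator C (state (restrict \<omega> {0..<Suc (Suc t)} (Suc t))) \<partial>path_law (Suc T))"
    by (intro nn_integral_cong) (auto simp: G' indicator_def Int_absorb1)
  also have "\<dots> = (\<integral>\<^sup>+\<omega>. indicator G' (restrict \<omega> {0..<Suc t}) * indicator C (state (\<omega> (Suc t))) \<partial>path_law (Suc (Suc t)))"
    using t restrict_measurable[of "Suc t" "Suc (Suc t)"]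
    by (intro nn_integral_path_law_restrict) (simp_all, measurable)
  also have "\<dots> = (\<integral>\<^sup>+\<omega>. indicator G' \<omega> * emeasure (K (Suc t) (state (\<omega> t))) C \<partial>path_law (Suc t))"
  proof (subst nn_integral_path_law_product)
    show "(\<integral>\<^sup>+\<omega>. indicator G' \<omega> * (\<integral>\<^sup>+s. \<integral>\<^sup>+r. indicator C (state (fst s, snd s, r)) \<partial>mark_law \<partial>next_state (Suc t) \<omega>) \<partial>path_law (Suc t)) =
      (\<integral>\<^sup>+\<omega>. indicator G' \<omega> * emeasure (K (Suc t) (state (\<omega> t))) C \<partial>path_law (Suc t))"
    proof (rule nn_integral_cong)
      fix \<omega> assume "\<omega> \<in> space (path_law (Suc t))"
      then have "state (\<omega> t) \<in> space (A \<Otimes>\<^sub>M B)"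
        by (intro measurable_space[OF state_measurable]) (auto simp: space_path_law space_PiM PiE_iff)
      then have "sets (K (Suc t) (state (\<omega> t))) = sets (A \<Otimes>\<^sub>M B)"
        by (rule sets_kernel[OF kernel_subprob])
      then show "indicator G' \<omega> * (\<integral>\<^sup>+s. \<integral>\<^sup>+r. indicator C (state (fst s, snd s, r)) \<partial>mark_law \<partial>next_state (Suc t) \<omega>) =
          indicator G' \<omega> * emeasure (K (Suc t) (state (\<omega> t))) C"
        using C by (simp only: nn_integral_mark_law_state) (simp add: next_state_def)
    qed
  qed measurable
  also have "\<dots> = (\<integral>\<^sup>+\<omega>. indicator G' (restrict \<omega> {0..<Suc t}) *
      emeasure (K (Suc t) (state (restrict \<omega> {0..<Suc t} t))) C \<partial>path_law (Suc T))"
    using t by (intro nn_integral_path_law_restrict[symmetric]) (simp_all, measurable)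
  also have "\<dots> = (\<integral>\<^sup>+\<omega>. indicator G \<omega> * ennreal (measure (K (Suc t) (state (\<omega> t))) C) \<partial>path_law (Suc T))"
    by (intro nn_integral_cong)
      (auto simp: G' indicator_def finite_measure.emeasure_eq_measure[OF prob_space.finite_measure[OF prob]])
  finally have eq: "(\<integral>\<^sup>+\<omega>. indicator G \<omega> * indicator C (state (\<omega> (Suc t))) \<partial>path_law (Suc T)) =
      (\<integral>\<^sup>+\<omega>. indicator G \<omega> * ennreal (measure (K (Suc t) (state (\<omega> t))) C) \<partial>path_law (Suc T))" .
  have "(\<integral>\<omega>\<in>G. indicator C (state (\<omega> (Suc t))) \<partial>path_law (Suc T)) =
      enn2real (\<integral>\<^sup>+\<omega>. indicator G \<omega> * indicator C (state (\<omega> (Suc t))) \<partial>path_law (Suc T))"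
    unfolding set_lebesgue_integral_def using meas_C meas_K
    by (subst integral_eq_nn_integral) (auto intro!: arg_cong[where f = enn2real] nn_integral_cong simp: indicator_def)
  also have "\<dots> = enn2real (\<integral>\<^sup>+\<omega>. indicator G \<omega> * ennreal (measure (K (Suc t) (state (\<omega> t))) C) \<partial>path_law (Suc T))"
    by (simp only: eq)
  also have "\<dots> = (\<integral>\<omega>\<in>G. measure (K (Suc t) (state (\<omega> t))) C \<partial>path_law (Suc T))"
    unfolding set_lebesgue_integral_def using meas_C meas_K
    by (subst integral_eq_nn_integral) (auto intro!: arg_cong[where f = enn2real] nn_integral_cong simp: indicator_def)
  finally show "(\<integral>\<omega>\<in>G. indicator C (state (\<omega> (Suc t))) \<partial>path_law (Suc T)) =
      (\<integral>\<omega>\<in>G. measure (K (Suc t) (state (\<omega> t))) C \<partial>path_law (Suc T))" .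
qed

section \<open>The killing time\<close>

definition kill_time :: "(nat \<Rightarrow> 'x \<times> 'u \<times> real) \<Rightarrow> nat" where
  "kill_time \<omega> = (LEAST s. \<not> survives s (\<omega> s))"

lemma le_kill_time_iff:
  assumes "\<not> survives T (\<omega> T)"
  shows "n \<le> kill_time \<omega> \<longleftrightarrow> alive n \<omega>"
proof
  assume n: "n \<le> kill_time \<omega>"
  show "alive n \<omega>"
    unfolding alive_def
  proof (intro allI impI)
    fix s assume "s < n"
    with n have "s < (LEAST s. \<not> survives s (\<omega> s))" by (simp add: kill_time_def)
    then show "survives s (\<omega> s)" by (blast dest: not_less_Least)
  qed
next
  assume n: "alive n \<omega>"
  have "\<not> survives (kill_time \<omega>) (\<omega> (kill_time \<omega>))"
    unfolding kill_time_def by (rule LeastI[of "\<lambda>s. \<not> survives s (\<omega> s)", OF assms])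
  with n have "\<not> kill_time \<omega> < n" unfolding alive_def by blast
  then show "n \<le> kill_time \<omega>" by simp
qed

lemma alive_measurable_history:
  assumes "n \<le> Suc t" "t \<le> T"
  shows "Measurable.pred (history T t) (alive n)"
proof -
  have "Measurable.pred (history T t) (\<lambda>\<omega>. alive n (restrict \<omega> {0..<Suc t}))"
    by (rule measurable_compose[OF restrict_measurable_history[OF assms(2)] alive_measurable[OF assms(1)]])
  moreover have "alive n (restrict \<omega> {0..<Suc t}) = alive n \<omega>" for \<omega>
    using assms by (auto simp: alive_def)
  ultimately show ?thesis by simp
qed

lemma
  assumes t: "t \<le> T" and C [measurable]: "C \<in> sets (A \<Otimes>\<^sub>M B)"
  shows emeasure_arrival: "emeasure (path_law (Suc T)) {\<omega>\<in>space (path_law (Suc T)). alive t \<omega> \<and> state (\<omega> t) \<in> C} =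
      emeasure (arrival t) C"
    and emeasure_survival: "emeasure (path_law (Suc T)) {\<omega>\<in>space (path_law (Suc T)). alive (Suc t) \<omega> \<and> state (\<omega> t) \<in> C} =
      emeasure (density (arrival t) (\<lambda>s. ennreal (a t s))) C"
    and alive_events: "{\<omega>\<in>space (path_law (Suc T)). alive t \<omega> \<and> state (\<omega> t) \<in> C} \<in> sets (path_law (Suc T))"
      "{\<omega>\<in>space (path_law (Suc T)). alive (Suc t) \<omega> \<and> state (\<omega> t) \<in> C} \<in> sets (path_law (Suc T))"
proof -
  have coord [measurable]: "(\<lambda>\<omega>. \<omega> t) \<in> path_law (Suc T) \<rightarrow>\<^sub>M points"
    "(\<lambda>\<omega>. \<omega> t) \<in> path_space (Suc t) \<rightarrow>\<^sub>M points"
    using t by (simp_all cong: measurable_cong_sets)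
  have event: "{\<omega>\<in>space (path_law (Suc T)). alive n \<omega> \<and> state (\<omega> t) \<in> C} \<in> sets (path_law (Suc T))" if "n \<le> Suc t" for n
  proof -
    have [measurable]: "Measurable.pred (path_law (Suc T)) (alive n)"
      using alive_measurable[of n "Suc T"] that t by (simp cong: measurable_cong_sets)
    show ?thesis by measurable
  qed
  have ind: "emeasure (path_law (Suc T)) {\<omega>\<in>space (path_law (Suc T)). alive n \<omega> \<and> state (\<omega> t) \<in> C} =
      (\<integral>\<^sup>+\<omega>. indicator (Collect (alive n)) \<omega> * indicator C (state (\<omega> t)) \<partial>path_law (Suc t))" if "n \<le> Suc t" for n
  proof -
    have [measurable]: "Measurable.pred (path_space (Suc t)) (alive n)"
      using that by (rule alive_measurable)
    have "emeasure (path_law (Suc T)) {\<omega>\<in>space (path_law (Suc T)). alive n \<omega> \<and> state (\<omega> t) \<in> C} =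
        (\<integral>\<^sup>+\<omega>. indicator (Collect (alive n)) (restrict \<omega> {0..<Suc t}) *
          indicator C (state (restrict \<omega> {0..<Suc t} t)) \<partial>path_law (Suc T))"
    proof (subst nn_integral_indicator[symmetric, OF event[OF that]], rule nn_integral_cong)
      fix \<omega> assume "\<omega> \<in> space (path_law (Suc T))"
      moreover have "alive n (restrict \<omega> {0..<Suc t}) = alive n \<omega>"
        using that by (auto simp: alive_def)
      ultimately show "indicator {\<omega> \<in> space (path_law (Suc T)). alive n \<omega> \<and> state (\<omega> t) \<in> C} \<omega> =
          (indicator (Collect (alive n)) (restrict \<omega> {0..<Suc t}) *
          indicator C (state (restrict \<omega> {0..<Suc t} t)) :: ennreal)"
        by (simp add: indicator_def)
    qed
    also have "\<dots> = (\<integral>\<^sup>+\<omega>. indicator (Collect (alive n)) \<omega> * indicator C (state (\<omega> t)) \<partial>path_law (Suc t))"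
      using t by (intro nn_integral_path_law_restrict) (simp, measurable)
    finally show ?thesis .
  qed
  show "emeasure (path_law (Suc T)) {\<omega>\<in>space (path_law (Suc T)). alive t \<omega> \<and> state (\<omega> t) \<in> C} = emeasure (arrival t) C"
    by (simp add: ind nn_integral_arrival)
  show "emeasure (path_law (Suc T)) {\<omega>\<in>space (path_law (Suc T)). alive (Suc t) \<omega> \<and> state (\<omega> t) \<in> C} =
      emeasure (density (arrival t) (\<lambda>s. ennreal (a t s))) C"
    by (subst ind[OF order_refl], subst nn_integral_survival) simp_all
  show "{\<omega>\<in>space (path_law (Suc T)). alive t \<omega> \<and> state (\<omega> t) \<in> C} \<in> sets (path_law (Suc T))"
      "{\<omega>\<in>space (path_law (Suc T)). alive (Suc t) \<omega> \<and> state (\<omega> t) \<in> C} \<in> sets (path_law (Suc T))"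
    by (rule event, simp)+
qed

definition completed_history :: "nat \<Rightarrow> nat \<Rightarrow> (nat \<Rightarrow> 'x \<times> 'u \<times> real) measure" where
  "completed_history T t = null_augmentation (path_law (Suc T)) (history T t)"

lemma complete_filtered_prob_space_paths:
  "complete_filtered_prob_space T (completion (path_law (Suc T))) (completed_history T)"
  unfolding complete_filtered_prob_space_def
proof (intro conjI ballI)
  show "prob_space (completion (path_law (Suc T)))"
    by (rule prob_space_completion) (rule prob_space_path_law)
  show "complete_measure (completion (path_law (Suc T)))"
    by (rule completion.complete_measure_axioms)
  show "filtration (space (completion (path_law (Suc T)))) (\<lambda>t. completed_history T (min t T))"
  proof
    fix i j :: nat assume "i \<le> j"
    then show "sets (completed_history T (min i T)) \<subseteq> sets (completed_history T (min j T))"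
      unfolding completed_history_def
      by (intro sets_null_augmentation_mono subalgebra_history sets_history_mono) auto
  qed (simp add: completed_history_def)
  fix t assume "t \<in> {0..T}"
  then have *: "subalgebra (path_law (Suc T)) (history T t)" by (intro subalgebra_history) simp
  show "sets (completed_history T t) \<subseteq> sets (completion (path_law (Suc T)))"
    using subalgebra_null_augmentation[OF *] by (simp add: completed_history_def subalgebra_def)
  show "null_sets (completion (path_law (Suc T))) \<subseteq> sets (completed_history T t)"
    using null_sets_le_null_augmentation[OF *] by (simp add: completed_history_def)
qed

lemma state_measurable_completed_history:
  assumes "t \<le> T"
  shows "(\<lambda>\<omega>. state (\<omega> t)) \<in> completed_history T t \<rightarrow>\<^sub>M A \<Otimes>\<^sub>M B"
  unfolding completed_history_def
  by (intro measurable_null_augmentation subalgebra_history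
      measurable_compose[OF coordinate_measurable_history state_measurable]) (use assms in auto)

text \<open>
  A vanishing survival probability at \<open>T\<close> kills every path by time \<open>T\<close>; and being killed by time \<open>t\<close>
  is the failure of \<open>alive (Suc t)\<close>, which the history of \<open>t\<close> decides.
\<close>

lemma stopping_time_kill_time:
  assumes "\<And>s. a T s = 0"
  shows "stopping_time_upto T (completed_history T) (completion (path_law (Suc T))) kill_time"
proof -
  have dead: "\<not> survives T y" for y by (auto simp: survives_def assms)
  have le: "n \<le> kill_time \<omega> \<longleftrightarrow> alive n \<omega>" for n \<omega>
    by (rule le_kill_time_iff[of T]) (rule dead)
  have bound: "kill_time \<omega> \<le> T" for \<omega>
    unfolding kill_time_def by (rule Least_le) (rule dead)
  show ?thesis
    unfolding stopping_time_upto_def stopping_time_def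
  proof (intro conjI allI ballI)
    fix t
    have iff: "kill_time \<omega> \<le> t \<longleftrightarrow> \<not> alive (Suc (min t T)) \<omega>" for \<omega>
      using bound[of \<omega>] by (auto simp: le[symmetric] min_def)
    have "Measurable.pred (completed_history T (min t T)) (alive (Suc (min t T)))"
      unfolding completed_history_def
      by (intro measurable_null_augmentation subalgebra_history alive_measurable_history) auto
    then show "Measurable.pred (completed_history T (min t T)) (\<lambda>\<omega>. kill_time \<omega> \<le> t)"
      unfolding iff by simp
  qed (simp add: bound)
qed

lemma kill_time_measurable:
  assumes dead: "\<And>s. a T s = 0"
  shows "kill_time \<in> completion (path_law (Suc T)) \<rightarrow>\<^sub>M count_space {0..T}"
proof (subst measurable_count_space_eq2)
  have "\<not> survives T y" for y by (auto simp: survives_def dead)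
  then have le: "n \<le> kill_time \<omega> \<longleftrightarrow> alive n \<omega>" for n \<omega>
    by (intro le_kill_time_iff[of T])
  have "kill_time \<omega> \<le> T" for \<omega>
    using \<open>\<And>y. \<not> survives T y\<close> unfolding kill_time_def by (intro Least_le) simp
  moreover have "kill_time -` {n} \<inter> space (completion (path_law (Suc T))) \<in> sets (completion (path_law (Suc T)))"
    if "n \<in> {0..T}" for n
  proof -
    have [measurable]: "Measurable.pred (path_law (Suc T)) (alive n)" "Measurable.pred (path_law (Suc T)) (alive (Suc n))"
      using alive_measurable[of n "Suc T"] alive_measurable[of "Suc n" "Suc T"] that
      by (simp_all cong: measurable_cong_sets)
    have "kill_time \<omega> = n \<longleftrightarrow> alive n \<omega> \<and> \<not> alive (Suc n) \<omega>" for \<omega>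
      using le[of n \<omega>] le[of "Suc n" \<omega>] by auto
    then have "kill_time -` {n} \<inter> space (completion (path_law (Suc T))) =
        {\<omega>\<in>space (path_law (Suc T)). alive n \<omega> \<and> \<not> alive (Suc n) \<omega>}" by auto
    also have "\<dots> \<in> sets (path_law (Suc T))" by measurable
    finally show ?thesis by (rule sets_completionI_sets)
  qed
  ultimately show "kill_time \<in> space (completion (path_law (Suc T))) \<rightarrow> {0..T} \<and>
    (\<forall>n\<in>{0..T}. kill_time -` {n} \<inter> space (completion (path_law (Suc T))) \<in> sets (completion (path_law (Suc T))))"
    by simp
qed simp

end

section \<open>Uniqueness of the marginals of a Markov chain\<close>

lemma complete_filtered_prob_space_subalgebra:
  assumes "complete_filtered_prob_space T M F" "s \<le> T"
  shows "subalgebra M (F s)"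
proof -
  have "space (F (min s T)) = space M"
    using assms(1) by (simp add: complete_filtered_prob_space_def filtration_def)
  then show ?thesis
    using assms by (simp add: complete_filtered_prob_space_def subalgebra_def)
qed

lemma markov_chain_measurable:
  assumes "complete_filtered_prob_space T M F" "markov_chain T W M F \<pi> X U" "s \<le> T"
  shows "(\<lambda>\<omega>. (X s \<omega>, U s \<omega>)) \<in> M \<rightarrow>\<^sub>M state_algebra W"
proof (rule measurable_from_subalg)
  show "subalgebra M (F s)" using assms(1,3) by (rule complete_filtered_prob_space_subalgebra)
  show "(\<lambda>\<omega>. (X s \<omega>, U s \<omega>)) \<in> F s \<rightarrow>\<^sub>M state_algebra W"
    using assms(2,3) by (simp add: markov_chain_def)
qed

text \<open>
  The expectation of the Markov property: the law at time \<open>t + 1\<close> is the image of the law at time \<open>t\<close>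
  under the kernel.
\<close>

lemma emeasure_markov_chain_step:
  fixes X :: "nat \<Rightarrow> 'a \<Rightarrow> 'e::topological_space"
  assumes M: "complete_filtered_prob_space T M F" and chain: "markov_chain T W M F \<pi> X U"
    and t: "Suc t \<le> T" and C: "C \<in> sets (state_algebra W)"
  shows "emeasure (distr M (state_algebra W) (\<lambda>\<omega>. (X (Suc t) \<omega>, U (Suc t) \<omega>))) C =
    (\<integral>\<^sup>+s. emeasure (\<pi> (Suc t) s) C \<partial>distr M (state_algebra W) (\<lambda>\<omega>. (X t \<omega>, U t \<omega>)))"
proof -
  let ?S = "state_algebra W :: ('e \<times> 'b) measure"
  interpret prob_space M using M by (simp add: complete_filtered_prob_space_def)
  interpret finite_measure_subalgebra M "F t" by standard (use complete_filtered_prob_space_subalgebra[OF M] t in simp)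
  have XUt [measurable]: "(\<lambda>\<omega>. (X t \<omega>, U t \<omega>)) \<in> M \<rightarrow>\<^sub>M ?S" "(\<lambda>\<omega>. (X (Suc t) \<omega>, U (Suc t) \<omega>)) \<in> M \<rightarrow>\<^sub>M ?S"
    using markov_chain_measurable[OF M chain] t by simp_all
  have pi: "\<pi> (Suc t) \<in> ?S \<rightarrow>\<^sub>M prob_algebra ?S"
    using chain t by (auto simp: markov_chain_def)
  note [measurable] = C measurable_prob_algebraD[OF pi]
  have int: "integrable M (\<lambda>\<omega>. indicator C (X (Suc t) \<omega>, U (Suc t) \<omega>) :: real)"
    by (intro integrable_const_bound[where B = 1]) (auto simp: indicator_def)
  have ae: "AE \<omega> in M. real_cond_exp M (F t) (\<lambda>\<omega>'. indicator C (X (Suc t) \<omega>', U (Suc t) \<omega>')) \<omega>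
      = measure (\<pi> (Suc t) (X t \<omega>, U t \<omega>)) C"
    using chain t C by (auto simp: markov_chain_def dest!: bspec[of _ _ "Suc t"])
  have prob: "prob_space (\<pi> (Suc t) (X t \<omega>, U t \<omega>))" if "\<omega> \<in> space M" for \<omega>
    using measurable_space[OF pi measurable_space[OF XUt(1) that]] by (simp add: space_prob_algebra)
  have "(\<integral>\<omega>. indicator C (X (Suc t) \<omega>, U (Suc t) \<omega>) \<partial>M) = (\<integral>\<omega>. measure (\<pi> (Suc t) (X t \<omega>, U t \<omega>)) C \<partial>M)"
    using real_cond_exp_int(2)[OF int] integral_cong_AE[OF _ _ ae] by simp
  then have eq: "(\<integral>\<^sup>+\<omega>. ennreal (indicator C (X (Suc t) \<omega>, U (Suc t) \<omega>)) \<partial>M) =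
      (\<integral>\<^sup>+\<omega>. ennreal (measure (\<pi> (Suc t) (X t \<omega>, U t \<omega>)) C) \<partial>M)"
    by (subst (1 2) nn_integral_eq_integral)
      (auto intro!: integrable_const_bound[where B = 1] AE_I2 prob_space.prob_le_1[OF prob] simp: indicator_def)
  have "emeasure (distr M ?S (\<lambda>\<omega>. (X (Suc t) \<omega>, U (Suc t) \<omega>))) C =
      (\<integral>\<^sup>+\<omega>. ennreal (indicator C (X (Suc t) \<omega>, U (Suc t) \<omega>)) \<partial>M)"
  proof -
    have "emeasure (distr M ?S (\<lambda>\<omega>. (X (Suc t) \<omega>, U (Suc t) \<omega>))) C =
      (\<integral>\<^sup>+s. indicator C s \<partial>distr M ?S (\<lambda>\<omega>. (X (Suc t) \<omega>, U (Suc t) \<omega>)))" by simp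
    also have "\<dots> = (\<integral>\<^sup>+\<omega>. ennreal (indicator C (X (Suc t) \<omega>, U (Suc t) \<omega>)) \<partial>M)"
      by (subst nn_integral_distr) (auto intro!: nn_integral_cong simp: indicator_def)
    finally show ?thesis .
  qed
  also note eq
  also have "(\<integral>\<^sup>+\<omega>. ennreal (measure (\<pi> (Suc t) (X t \<omega>, U t \<omega>)) C) \<partial>M) =
      (\<integral>\<^sup>+\<omega>. emeasure (\<pi> (Suc t) (X t \<omega>, U t \<omega>)) C \<partial>M)"
    by (intro nn_integral_cong) (simp add: finite_measure.emeasure_eq_measure[OF prob_space.finite_measure[OF prob]])
  also have "\<dots> = (\<integral>\<^sup>+s. emeasure (\<pi> (Suc t) s) C \<partial>distr M ?S (\<lambda>\<omega>. (X t \<omega>, U t \<omega>)))"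
    by (subst nn_integral_distr) simp_all
  finally show ?thesis .
qed

lemma markov_chain_marginals_unique:
  fixes X :: "nat \<Rightarrow> 'a \<Rightarrow> 'e::topological_space" and X' :: "nat \<Rightarrow> 'b \<Rightarrow> 'e"
  assumes "complete_filtered_prob_space T M F" "markov_chain T W M F \<pi> X U"
    and "complete_filtered_prob_space T M' F'" "markov_chain T W M' F' \<pi> X' U'"
    and "distr M (state_algebra W) (\<lambda>\<omega>. (X 0 \<omega>, U 0 \<omega>)) = distr M' (state_algebra W) (\<lambda>\<omega>. (X' 0 \<omega>, U' 0 \<omega>))"
    and "t \<le> T"
  shows "distr M (state_algebra W) (\<lambda>\<omega>. (X t \<omega>, U t \<omega>)) = distr M' (state_algebra W) (\<lambda>\<omega>. (X' t \<omega>, U' t \<omega>))"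
  using \<open>t \<le> T\<close>
proof (induction t)
  case (Suc t)
  then show ?case
    using assms(1-4) by (intro measure_eqI) (simp_all add: emeasure_markov_chain_step)
qed (use assms in simp)

section \<open>Finite mixtures and the law of the noise\<close>

text \<open>
  The measure \<open>\<Sum>i\<in>I. w i * N i\<close>. Writing it as a composition with a kernel makes the integration
  formulas for \<open>bind\<close> available.
\<close>

definition mixture :: "'i set \<Rightarrow> ('i \<Rightarrow> real) \<Rightarrow> ('i \<Rightarrow> 's measure) \<Rightarrow> 's measure" where
  "mixture I w N = density (count_space I) (\<lambda>i. ennreal (w i)) \<bind> N"

context
  fixes I :: "'i set" and w :: "'i \<Rightarrow> real" and N :: "'i \<Rightarrow> 's measure" and S
  assumes I: "finite I" "I \<noteq> {}" and w: "\<And>i. i \<in> I \<Longrightarrow> 0 \<le> w i"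
    and N: "\<And>i. i \<in> I \<Longrightarrow> N i \<in> space (subprob_algebra S)"
begin

lemma sets_mixture: "sets (mixture I w N) = sets S"
  unfolding mixture_def by (rule sets_bind) (use I N in \<open>auto simp: space_subprob_algebra\<close>)

lemma nn_integral_mixture:
  assumes "f \<in> borel_measurable S"
  shows "(\<integral>\<^sup>+s. f s \<partial>mixture I w N) = (\<Sum>i\<in>I. ennreal (w i) * (\<integral>\<^sup>+s. f s \<partial>N i))"
proof -
  have "(\<integral>\<^sup>+s. f s \<partial>mixture I w N) = (\<integral>\<^sup>+i. \<integral>\<^sup>+s. f s \<partial>N i \<partial>density (count_space I) (\<lambda>i. ennreal (w i)))"
    unfolding mixture_def by (rule nn_integral_bind[OF assms]) (use N in auto)
  also have "\<dots> = (\<Sum>i\<in>I. ennreal (w i) * (\<integral>\<^sup>+s. f s \<partial>N i))"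
    using I by (subst nn_integral_density) (simp_all add: nn_integral_count_space_finite)
  finally show ?thesis .
qed

lemma emeasure_mixture:
  assumes "C \<in> sets S"
  shows "emeasure (mixture I w N) C = (\<Sum>i\<in>I. ennreal (w i) * emeasure (N i) C)"
proof -
  have "C \<in> sets (mixture I w N)" "\<And>i. i \<in> I \<Longrightarrow> C \<in> sets (N i)"
    using assms N by (auto simp: sets_mixture space_subprob_algebra)
  then show ?thesis
    using nn_integral_mixture[of "indicator C"] assms by simp
qed

lemma mixture_in_subprob_algebra:
  assumes "space S \<noteq> {}" "sum w I \<le> 1"
  shows "mixture I w N \<in> space (subprob_algebra S)"
  unfolding space_subprob_algebra
proof (intro CollectI conjI subprob_spaceI)
  have sp: "space (mixture I w N) = space S" by (rule sets_eq_imp_space_eq[OF sets_mixture])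
  have "emeasure (mixture I w N) (space S) = (\<Sum>i\<in>I. ennreal (w i) * emeasure (N i) (space S))"
    by (rule emeasure_mixture) simp
  also have "\<dots> \<le> (\<Sum>i\<in>I. ennreal (w i) * 1)"
  proof (intro sum_mono mult_left_mono)
    fix i assume "i \<in> I"
    then have "subprob_space (N i)" "sets (N i) = sets S"
      using N by (auto simp: space_subprob_algebra)
    then show "emeasure (N i) (space S) \<le> 1"
      using subprob_space.subprob_emeasure_le_1 by blast
  qed simp
  also have "\<dots> = ennreal (sum w I)" using w by (simp add: sum_ennreal)
  also have "\<dots> \<le> 1" using assms by (simp add: ennreal_le_1)
  finally show "emeasure (mixture I w N) (space (mixture I w N)) \<le> 1" by (simp add: sp)
  show "space (mixture I w N) \<noteq> {}" using assms by (simp add: sp)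
qed (rule sets_mixture)

end

lemma subprobs_iff: "N \<in> subprobs K \<longleftrightarrow> subprob_space N \<and> sets N = sets (restrict_space borel K)"
  by (simp add: subprobs_def space_subprob_algebra)

text \<open>
  Glues measures \<open>n u\<close> on \<open>E\<close> to one measure on \<open>E \<times> W\<close> that charges the fibre over \<open>u\<close> with
  \<open>w u * n u\<close>. The measures \<open>n u\<close> may live on a subset \<open>K\<close> of \<open>E\<close>; this covers both families
  in the constraint.
\<close>

definition attach_noise ::
    "'u set \<Rightarrow> 'u set \<Rightarrow> ('u \<Rightarrow> real) \<Rightarrow> ('u \<Rightarrow> 'e::topological_space measure) \<Rightarrow> ('e \<times> 'u) measure" where
  "attach_noise W I w n = mixture I w (\<lambda>u. distr (n u) (state_algebra W) (\<lambda>x. (x, u)))"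

context
  fixes W I :: "'u set" and w :: "'u \<Rightarrow> real" and n :: "'u \<Rightarrow> 'e::topological_space measure" and K
  assumes I: "finite I" "I \<noteq> {}" "I \<subseteq> W" and w: "\<And>u. u \<in> I \<Longrightarrow> 0 \<le> w u"
    and n: "\<And>u. u \<in> I \<Longrightarrow> n u \<in> subprobs K"
begin

lemma attach_noise_component: "u \<in> I \<Longrightarrow> distr (n u) (state_algebra W) (\<lambda>x. (x, u)) \<in> space (subprob_algebra (state_algebra W))"
  using n[of u] I(3)
  by (auto simp: space_subprob_algebra subprobs_iff space_state_algebra
      intro!: subprob_space.subprob_space_distr section_measurable_state_algebra)

lemma sets_attach_noise: "sets (attach_noise W I w n) = sets (state_algebra W)"
  unfolding attach_noise_def by (rule sets_mixture) (use I w attach_noise_component in auto)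

lemma attach_noise_in_subprob_algebra:
  assumes "sum w I \<le> 1"
  shows "attach_noise W I w n \<in> space (subprob_algebra (state_algebra W))"
  unfolding attach_noise_def
  by (rule mixture_in_subprob_algebra) (use I w attach_noise_component assms in \<open>auto simp: space_state_algebra\<close>)

lemma nn_integral_attach_noise:
  fixes f :: "'e \<times> 'u \<Rightarrow> real"
  assumes f: "f \<in> borel_measurable (state_algebra W)" and b: "\<And>s. s \<in> UNIV \<times> W \<Longrightarrow> 0 \<le> f s \<and> f s \<le> 1"
  shows "(\<integral>\<^sup>+s. ennreal (f s) \<partial>attach_noise W I w n) = ennreal (\<Sum>u\<in>I. w u * (\<integral>x. f (x, u) \<partial>n u))"
proof -
  have "(\<integral>\<^sup>+s. ennreal (f s) \<partial>attach_noise W I w n) =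
      (\<Sum>u\<in>I. ennreal (w u) * (\<integral>\<^sup>+s. ennreal (f s) \<partial>distr (n u) (state_algebra W) (\<lambda>x. (x, u))))"
    unfolding attach_noise_def
    by (rule nn_integral_mixture) (use I w attach_noise_component f in \<open>auto\<close>)
  also have "\<dots> = (\<Sum>u\<in>I. ennreal (w u * (\<integral>x. f (x, u) \<partial>n u)))"
  proof (rule sum.cong[OF refl])
    fix u assume u: "u \<in> I"
    then have uW: "u \<in> W" using I by auto
    interpret subprob_space "n u" using n[OF u] by (simp add: subprobs_iff)
    have m: "(\<lambda>x. (x, u)) \<in> n u \<rightarrow>\<^sub>M state_algebra W"
      using n[OF u] uW by (intro section_measurable_state_algebra) (auto simp: subprobs_iff)
    have fm: "(\<lambda>x. f (x, u)) \<in> borel_measurable (n u)" by (rule measurable_compose[OF m f])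
    have "(\<integral>\<^sup>+s. ennreal (f s) \<partial>distr (n u) (state_algebra W) (\<lambda>x. (x, u))) = (\<integral>\<^sup>+x. ennreal (f (x, u)) \<partial>n u)"
      using f by (intro nn_integral_distr m) simp
    also have "\<dots> = ennreal (\<integral>x. f (x, u) \<partial>n u)"
      using fm b uW by (intro nn_integral_eq_integral integrable_const_bound[where B = 1]) auto
    finally show "ennreal (w u) * (\<integral>\<^sup>+s. ennreal (f s) \<partial>distr (n u) (state_algebra W) (\<lambda>x. (x, u))) =
        ennreal (w u * (\<integral>x. f (x, u) \<partial>n u))"
      using w[OF u] by (simp add: ennreal_mult')
  qed
  also have "\<dots> = ennreal (\<Sum>u\<in>I. w u * (\<integral>x. f (x, u) \<partial>n u))"
    using w b I by (intro sum_ennreal mult_nonneg_nonneg Bochner_Integration.integral_nonneg) auto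
  finally show ?thesis .
qed

lemma emeasure_attach_noise:
  assumes C: "C \<in> sets (state_algebra W)"
  shows "emeasure (attach_noise W I w n) C = (\<Sum>u\<in>I. ennreal (w u) * emeasure (n u) {x\<in>space (n u). (x, u) \<in> C})"
proof -
  have "emeasure (attach_noise W I w n) C =
      (\<Sum>u\<in>I. ennreal (w u) * emeasure (distr (n u) (state_algebra W) (\<lambda>x. (x, u))) C)"
    unfolding attach_noise_def
    by (rule emeasure_mixture) (use I w attach_noise_component C in \<open>auto\<close>)
  also have "\<dots> = (\<Sum>u\<in>I. ennreal (w u) * emeasure (n u) {x\<in>space (n u). (x, u) \<in> C})"
  proof (rule sum.cong[OF refl])
    fix u assume u: "u \<in> I"
    have m: "(\<lambda>x. (x, u)) \<in> n u \<rightarrow>\<^sub>M state_algebra W"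
      using n[OF u] u I by (intro section_measurable_state_algebra) (auto simp: subprobs_iff)
    have "(\<lambda>x. (x, u)) -` C \<inter> space (n u) = {x\<in>space (n u). (x, u) \<in> C}" by auto
    then show "ennreal (w u) * emeasure (distr (n u) (state_algebra W) (\<lambda>x. (x, u))) C =
        ennreal (w u) * emeasure (n u) {x\<in>space (n u). (x, u) \<in> C}"
      by (simp add: emeasure_distr[OF m C])
  qed
  finally show ?thesis .
qed

lemma emeasure_attach_noise_rectangle:
  assumes u: "u \<in> I" and B: "B \<in> sets borel" "B \<in> sets (n u)"
  shows "emeasure (attach_noise W I w n) (B \<times> {u}) = ennreal (w u) * emeasure (n u) B"
proof -
  have "B \<times> {u} \<in> sets (state_algebra W)"
    using u B I by (intro rectangle_in_state_algebra) auto
  then have "emeasure (attach_noise W I w n) (B \<times> {u}) =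
      (\<Sum>v\<in>I. ennreal (w v) * emeasure (n v) {x\<in>space (n v). (x, v) \<in> B \<times> {u}})"
    by (rule emeasure_attach_noise)
  also have "\<dots> = (\<Sum>v\<in>I. if v = u then ennreal (w u) * emeasure (n u) B else 0)"
  proof (rule sum.cong[OF refl])
    fix v assume "v \<in> I"
    show "ennreal (w v) * emeasure (n v) {x\<in>space (n v). (x, v) \<in> B \<times> {u}} =
        (if v = u then ennreal (w u) * emeasure (n u) B else 0)"
    proof (cases "v = u")
      case True
      have "{x\<in>space (n u). x \<in> B} = B" using sets.sets_into_space[OF B(2)] by auto
      then show ?thesis using True by simp
    qed simp
  qed
  also have "\<dots> = ennreal (w u) * emeasure (n u) B"
    using I u by simp
  finally show ?thesis .
qed

end

context
  fixes T :: nat and W :: "'u set" and M :: "'a measure" and X :: "nat \<Rightarrow> 'a \<Rightarrow> 'e::topological_space" and U :: "nat \<Rightarrow> 'a \<Rightarrow> 'u" and t :: nat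
  assumes M: "prob_space M" and W: "finite W"
    and XU: "(\<lambda>\<omega>. (X t \<omega>, U t \<omega>)) \<in> M \<rightarrow>\<^sub>M state_algebra W"
begin

lemma noise_event: "u \<in> W \<Longrightarrow> {\<omega>\<in>space M. U t \<omega> = u} \<in> sets M"
proof -
  assume "u \<in> W"
  from measurable_sets[OF XU rectangle_in_state_algebra[OF _ this, of UNIV]]
  show ?thesis by (simp add: vimage_def Int_def conj_commute)
qed

lemma noise_prob_eq_distr:
  assumes "u \<in> W"
  shows "noise_prob M U t u = measure (distr M (state_algebra W) (\<lambda>\<omega>. (X t \<omega>, U t \<omega>))) (UNIV \<times> {u})"
proof -
  have "(\<lambda>\<omega>. (X t \<omega>, U t \<omega>)) -` (UNIV \<times> {u}) \<inter> space M = {\<omega>\<in>space M. U t \<omega> = u}" by auto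
  then show ?thesis
    using assms by (simp add: noise_prob_def measure_distr[OF XU] rectangle_in_state_algebra)
qed

lemma noise_supp_subset: "noise_supp W M U t \<subseteq> W" "finite (noise_supp W M U t)"
  using W by (auto simp: noise_supp_def)

lemma sum_noise_prob: "sum (noise_prob M U t) (noise_supp W M U t) = 1"
proof -
  interpret prob_space M by (rule M)
  have in_W: "U t \<omega> \<in> W" if "\<omega> \<in> space M" for \<omega>
    using measurable_space[OF XU that] by (simp add: space_state_algebra)
  have "sum (noise_prob M U t) (noise_supp W M U t) = sum (noise_prob M U t) W"
    using W by (intro sum.mono_neutral_left) (auto simp: noise_supp_def noise_prob_def less_le)
  also have "\<dots> = measure M (\<Union>u\<in>W. {\<omega>\<in>space M. U t \<omega> = u})"
    unfolding noise_prob_def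
    by (rule finite_measure_finite_Union[symmetric]) (use W noise_event in \<open>auto simp: disjoint_family_on_def\<close>)
  also have "(\<Union>u\<in>W. {\<omega>\<in>space M. U t \<omega> = u}) = space M" using in_W by auto
  finally show ?thesis by (simp add: prob_space)
qed

lemma noise_supp_not_empty: "noise_supp W M U t \<noteq> {}"
  using sum_noise_prob by auto

end

context
  fixes W :: "'u set" and M :: "'a measure" and X :: "nat \<Rightarrow> 'a \<Rightarrow> 'e::topological_space" and U :: "nat \<Rightarrow> 'a \<Rightarrow> 'u"
  assumes M: "prob_space M" and W: "finite W"
    and XU: "(\<lambda>\<omega>. (X 0 \<omega>, U 0 \<omega>)) \<in> M \<rightarrow>\<^sub>M state_algebra W"
begin

lemmas noise_event_0 = noise_event[where t = 0 and X = X and U = U, OF M W XU]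
  and noise_supp_subset_0 = noise_supp_subset[where t = 0 and X = X and U = U, OF M W XU]
  and noise_supp_not_empty_0 = noise_supp_not_empty[where t = 0 and X = X and U = U, OF M W XU]

lemma X0_measurable: "X 0 \<in> M \<rightarrow>\<^sub>M borel"
  using measurable_compose[OF XU, of fst borel] unfolding state_algebra_def by simp

lemma init_cond_law_prob:
  assumes u: "u \<in> noise_supp W M U 0"
  shows "prob_space (init_cond_law M X U u)" "init_cond_law M X U u \<in> subprobs UNIV"
proof -
  interpret prob_space M by (rule M)
  have "emeasure M {\<omega>\<in>space M. U 0 \<omega> = u} \<noteq> 0"
    using u by (auto simp: noise_supp_def noise_prob_def measure_def)
  then have "prob_space (uniform_measure M {\<omega>\<in>space M. U 0 \<omega> = u})"
    by (intro prob_space_uniform_measure) auto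
  then show "prob_space (init_cond_law M X U u)"
    unfolding init_cond_law_def using X0_measurable
    by (intro prob_space.prob_space_distr) (simp_all cong: measurable_cong_sets)
  then show "init_cond_law M X U u \<in> subprobs UNIV"
    by (simp add: subprobs_iff prob_space_imp_subprob_space init_cond_law_def sets_restrict_space)
qed

lemma measure_initial_law:
  assumes C: "C \<in> sets (state_algebra W)"
  shows "\<P>(\<omega> in M. (X 0 \<omega>, U 0 \<omega>) \<in> C) =
    (\<Sum>u\<in>noise_supp W M U 0. measure (init_cond_law M X U u) {x. (x, u) \<in> C} * noise_prob M U 0 u)"
proof -
  interpret prob_space M by (rule M)
  have CM: "{\<omega>\<in>space M. (X 0 \<omega>, U 0 \<omega>) \<in> C} \<in> sets M"
    using measurable_sets[OF XU C] by (simp add: vimage_def Int_def conj_commute)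
  have in_W: "U 0 \<omega> \<in> W" if "\<omega> \<in> space M" for \<omega>
    using measurable_space[OF XU that] by (simp add: space_state_algebra)
  have ev: "{\<omega>\<in>space M. (X 0 \<omega>, U 0 \<omega>) \<in> C \<and> U 0 \<omega> = u} \<in> sets M" if "u \<in> W" for u
  proof -
    have "{\<omega>\<in>space M. (X 0 \<omega>, U 0 \<omega>) \<in> C \<and> U 0 \<omega> = u} = {\<omega>\<in>space M. (X 0 \<omega>, U 0 \<omega>) \<in> C} \<inter> {\<omega>\<in>space M. U 0 \<omega> = u}"
      by auto
    then show ?thesis using CM noise_event_0[OF that] by auto
  qed
  have "\<P>(\<omega> in M. (X 0 \<omega>, U 0 \<omega>) \<in> C) = measure M (\<Union>u\<in>W. {\<omega>\<in>space M. (X 0 \<omega>, U 0 \<omega>) \<in> C \<and> U 0 \<omega> = u})"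
    using in_W by (intro arg_cong[where f = "measure M"]) auto
  also have "\<dots> = (\<Sum>u\<in>W. measure M {\<omega>\<in>space M. (X 0 \<omega>, U 0 \<omega>) \<in> C \<and> U 0 \<omega> = u})"
    by (rule finite_measure_finite_Union) (use W ev in \<open>auto simp: disjoint_family_on_def\<close>)
  also have "\<dots> = (\<Sum>u\<in>noise_supp W M U 0. measure M {\<omega>\<in>space M. (X 0 \<omega>, U 0 \<omega>) \<in> C \<and> U 0 \<omega> = u})"
  proof (rule sum.mono_neutral_right)
    show "\<forall>u\<in>W - noise_supp W M U 0. measure M {\<omega>\<in>space M. (X 0 \<omega>, U 0 \<omega>) \<in> C \<and> U 0 \<omega> = u} = 0"
    proof
      fix u assume u: "u \<in> W - noise_supp W M U 0"
      then have "measure M {\<omega>\<in>space M. U 0 \<omega> = u} \<le> 0"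
        by (auto simp: noise_supp_def noise_prob_def)
      moreover have "measure M {\<omega>\<in>space M. (X 0 \<omega>, U 0 \<omega>) \<in> C \<and> U 0 \<omega> = u} \<le> measure M {\<omega>\<in>space M. U 0 \<omega> = u}"
        using u noise_event_0[of u] by (intro finite_measure_mono) auto
      ultimately show "measure M {\<omega>\<in>space M. (X 0 \<omega>, U 0 \<omega>) \<in> C \<and> U 0 \<omega> = u} = 0"
        using measure_nonneg[of M "{\<omega>\<in>space M. (X 0 \<omega>, U 0 \<omega>) \<in> C \<and> U 0 \<omega> = u}"] by linarith
    qed
  qed (use W in \<open>auto simp: noise_supp_def\<close>)
  also have "\<dots> = (\<Sum>u\<in>noise_supp W M U 0. measure (init_cond_law M X U u) {x. (x, u) \<in> C} * noise_prob M U 0 u)"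
  proof (rule sum.cong[OF refl])
    fix u assume u: "u \<in> noise_supp W M U 0"
    then have uW: "u \<in> W" and pos: "noise_prob M U 0 u > 0" by (auto simp: noise_supp_def)
    have "{x. (x, u) \<in> C} \<in> sets borel"
      using measurable_sets[OF section_measurable_state_algebra[OF uW, of borel UNIV] C]
      by (simp add: vimage_def sets_restrict_space)
    then have "measure (init_cond_law M X U u) {x. (x, u) \<in> C} = \<P>(\<omega> in M. X 0 \<omega> \<in> {x. (x, u) \<in> C} \<bar> U 0 \<omega> = u)"
      using X0_measurable noise_event_0[OF uW] pos by (intro measure_init_cond_law M)
    then have "measure (init_cond_law M X U u) {x. (x, u) \<in> C} * noise_prob M U 0 u =
        measure M {\<omega>\<in>space M. (X 0 \<omega>, u) \<in> C \<and> U 0 \<omega> = u}"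
      using pos by (simp add: cond_prob_def noise_prob_def)
    also have "{\<omega>\<in>space M. (X 0 \<omega>, u) \<in> C \<and> U 0 \<omega> = u} = {\<omega>\<in>space M. (X 0 \<omega>, U 0 \<omega>) \<in> C \<and> U 0 \<omega> = u}" by auto
    finally show "measure M {\<omega>\<in>space M. (X 0 \<omega>, U 0 \<omega>) \<in> C \<and> U 0 \<omega> = u} =
        measure (init_cond_law M X U u) {x. (x, u) \<in> C} * noise_prob M U 0 u" ..
  qed
  finally show ?thesis .
qed

text \<open>
  Disintegration of the initial law along \<open>U 0\<close>: it puts the initial term of the constraint into the
  same form as the other terms.
\<close>

lemma initial_law_eq_attach_noise:
  "distr M (state_algebra W) (\<lambda>\<omega>. (X 0 \<omega>, U 0 \<omega>)) =
    attach_noise W (noise_supp W M U 0) (noise_prob M U 0) (init_cond_law M X U)"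
proof (rule measure_eqI)
  interpret prob_space M by (rule M)
  have hyp: "finite (noise_supp W M U 0)" "noise_supp W M U 0 \<noteq> {}" "noise_supp W M U 0 \<subseteq> W"
      "\<And>u. 0 \<le> noise_prob M U 0 u"
    using noise_supp_subset_0 noise_supp_not_empty_0 by (auto simp: noise_prob_def)
  show "sets (distr M (state_algebra W) (\<lambda>\<omega>. (X 0 \<omega>, U 0 \<omega>))) =
      sets (attach_noise W (noise_supp W M U 0) (noise_prob M U 0) (init_cond_law M X U))"
    using hyp init_cond_law_prob by (subst sets_attach_noise[where K = UNIV]) auto
  fix C assume "C \<in> sets (distr M (state_algebra W) (\<lambda>\<omega>. (X 0 \<omega>, U 0 \<omega>)))"
  then have C: "C \<in> sets (state_algebra W)" by simp
  have "emeasure (attach_noise W (noise_supp W M U 0) (noise_prob M U 0) (init_cond_law M X U)) C =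
      (\<Sum>u\<in>noise_supp W M U 0. ennreal (noise_prob M U 0 u) *
        emeasure (init_cond_law M X U u) {x\<in>space (init_cond_law M X U u). (x, u) \<in> C})"
    using hyp init_cond_law_prob C by (intro emeasure_attach_noise[where K = UNIV]) auto
  also have "\<dots> = (\<Sum>u\<in>noise_supp W M U 0. ennreal (measure (init_cond_law M X U u) {x. (x, u) \<in> C} * noise_prob M U 0 u))"
  proof (rule sum.cong[OF refl])
    fix u assume "u \<in> noise_supp W M U 0"
    then interpret L: prob_space "init_cond_law M X U u" by (rule init_cond_law_prob)
    show "ennreal (noise_prob M U 0 u) * emeasure (init_cond_law M X U u) {x\<in>space (init_cond_law M X U u). (x, u) \<in> C} =
        ennreal (measure (init_cond_law M X U u) {x. (x, u) \<in> C} * noise_prob M U 0 u)"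
    proof -
      have "space (init_cond_law M X U u) = UNIV" by (simp add: init_cond_law_def)
      then show ?thesis
        using hyp(4) by (simp add: L.emeasure_eq_measure ennreal_mult mult.commute)
    qed
  qed
  also have "\<dots> = ennreal (\<P>(\<omega> in M. (X 0 \<omega>, U 0 \<omega>) \<in> C))"
    unfolding measure_initial_law[OF C] using hyp by (intro sum_ennreal) simp
  also have "\<dots> = emeasure (distr M (state_algebra W) (\<lambda>\<omega>. (X 0 \<omega>, U 0 \<omega>))) C"
    by (simp add: emeasure_distr[OF XU C] emeasure_eq_measure vimage_def Int_def conj_commute)
  finally show "emeasure (distr M (state_algebra W) (\<lambda>\<omega>. (X 0 \<omega>, U 0 \<omega>))) C =
      emeasure (attach_noise W (noise_supp W M U 0) (noise_prob M U 0) (init_cond_law M X U)) C" ..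
qed

lemma AE_init_cond_law:
  assumes u: "u \<in> noise_supp W M U 0" and D: "D \<in> sets borel" and ae: "AE \<omega> in M. X 0 \<omega> \<in> D"
  shows "AE x in init_cond_law M X U u. x \<in> D"
proof -
  have "AE \<omega> in uniform_measure M {\<omega>\<in>space M. U 0 \<omega> = u}. X 0 \<omega> \<in> D"
    using ae noise_event_0[of u] u
    by (intro AE_uniform_measureI) (auto simp: noise_supp_def)
  then show ?thesis
    unfolding init_cond_law_def using X0_measurable D
    by (subst AE_distr_iff) (auto cong: measurable_cong_sets)
qed

end

section \<open>Mass balance in the constraint set\<close>

lemma slot_function_measurable:
  fixes h :: "'e::topological_space \<Rightarrow> real"
  assumes "continuous_on UNIV h"
  shows "(\<lambda>s. h (fst s) * of_bool (snd s = u)) \<in> borel_measurable (state_algebra W)"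
proof -
  have [measurable]: "h \<in> borel_measurable borel" using assms by (rule borel_measurable_continuous_onI)
  have [measurable]: "(\<lambda>s. of_bool (snd s = u) :: real) \<in> borel_measurable (borel \<Otimes>\<^sub>M count_space W)"
    using measurable_compose[OF measurable_snd, of "\<lambda>v. of_bool (v = u)"] by simp
  show ?thesis unfolding state_algebra_def by measurable
qed

lemma slot_test_function_continuous:
  fixes h :: "'e::topological_space \<Rightarrow> real"
  assumes h: "continuous_on UNIV h"
  shows "continuous_map (prod_topology (discrete_topology J) (state_topology W)) euclideanreal
    (\<lambda>(s, x, v). of_bool (s = t) * (h x * of_bool (v = u)))"
proof -
  have disc: "continuous_map (discrete_topology A) euclideanreal f" for A :: "'z set" and f
    by (simp add: continuous_map_def)
  have hc: "continuous_map euclidean euclideanreal h" using h by simp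
  let ?X = "prod_topology (discrete_topology J) (prod_topology euclidean (discrete_topology W))"
  have "continuous_map ?X euclidean (fst \<circ> snd)" "continuous_map ?X (discrete_topology W) (snd \<circ> snd)"
    by (rule continuous_map_compose[OF continuous_map_snd continuous_map_fst]
        continuous_map_compose[OF continuous_map_snd continuous_map_snd])+
  from continuous_map_compose[OF this(1) hc] continuous_map_compose[OF this(2) disc]
    continuous_map_compose[OF continuous_map_fst disc]
  have "continuous_map ?X euclideanreal
    (\<lambda>p. ((\<lambda>s. of_bool (s = t)) \<circ> fst) p * ((h \<circ> (fst \<circ> snd)) p * ((\<lambda>v. of_bool (v = u)) \<circ> (snd \<circ> snd)) p))"
    by (intro continuous_map_real_mult)
  moreover have "(\<lambda>(s, x, v). of_bool (s = t) * (h x * of_bool (v = u))) =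
    (\<lambda>p. ((\<lambda>s. of_bool (s = t)) \<circ> fst) p * ((h \<circ> (fst \<circ> snd)) p * ((\<lambda>v. of_bool (v = u)) \<circ> (snd \<circ> snd)) p))"
    by (auto simp: fun_eq_iff)
  ultimately show ?thesis by (simp add: state_topology_def)
qed

text \<open>
  Insert \<open>\<phi> (s, x, v) = of_bool (s = t) * k (x, v)\<close> into the constraint. The generator of this
  function at time \<open>s\<close> is the kernel applied to \<open>k\<close> if \<open>s = t - 1\<close>, is \<open>- k\<close> if \<open>s = t\<close>, and
  vanishes otherwise, so only the terms of the times \<open>t - 1\<close> and \<open>t\<close> remain.
\<close>

lemma constraint_balance:
  fixes X :: "nat \<Rightarrow> 'a \<Rightarrow> 'e::topological_space" and h :: "'e \<Rightarrow> real" and u :: 'u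
  assumes R: "(\<mu>, m) \<in> constraint_set T D W M X U \<pi>"
    and pi: "\<And>t. t \<in> {1..T} \<Longrightarrow> \<pi> t \<in> state_algebra W \<rightarrow>\<^sub>M prob_algebra (state_algebra W)"
    and h: "continuous_on UNIV h" "\<And>x. 0 \<le> h x \<and> h x \<le> 1" and t: "t \<le> T"
  defines "k \<equiv> \<lambda>s. h (fst s) * of_bool (snd s = u)"
  shows "(\<Sum>v\<in>noise_supp W M U t. noise_prob M U t v * (\<integral>x. k (x, v) \<partial>\<mu> t v)) +
      (if t < T then (\<Sum>v\<in>noise_supp W M U t. noise_prob M U t v * (\<integral>x. k (x, v) \<partial>m t v)) else 0) =
      (case t of 0 \<Rightarrow> (\<Sum>v\<in>noise_supp W M U 0. noise_prob M U 0 v * (LINT x:D|init_cond_law M X U v. k (x, v)))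
        | Suc r \<Rightarrow> (\<Sum>v\<in>noise_supp W M U r. noise_prob M U r v * (\<integral>x. (\<integral>s. k s \<partial>\<pi> t (x, v)) \<partial>m r v)))"
proof -
  let ?\<Omega> = "noise_supp W M U" and ?p = "noise_prob M U"
  define \<phi> :: "nat \<times> 'e \<times> 'u \<Rightarrow> real" where "\<phi> = (\<lambda>(s, x, v). of_bool (s = t) * (h x * of_bool (v = u)))"
  have \<phi>: "\<phi> (s, x, v) = of_bool (s = t) * k (x, v)" for s x v
    by (simp add: \<phi>_def k_def)
  have km [measurable]: "k \<in> borel_measurable (state_algebra W)"
    unfolding k_def using h(1) by (rule slot_function_measurable)
  have kb: "0 \<le> k s" "k s \<le> 1" for s using h(2)[of "fst s"] by (auto simp: k_def)
  have \<Omega>W: "v \<in> ?\<Omega> s \<Longrightarrow> v \<in> W" for s v by (auto simp: noise_supp_def)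
  have kernel: "prob_space (\<pi> (Suc s) (x, v))" "sets (\<pi> (Suc s) (x, v)) = sets (state_algebra W)"
    if "s < T" "v \<in> W" for s x v
    using measurable_space[OF pi[of "Suc s"], of "(x, v)"] that by (auto simp: space_prob_algebra space_state_algebra)
  have kint: "integrable (\<pi> (Suc s) (x, v)) k" "0 \<le> (\<integral>y. k y \<partial>\<pi> (Suc s) (x, v))" "(\<integral>y. k y \<partial>\<pi> (Suc s) (x, v)) \<le> 1"
    if "s < T" "v \<in> W" for s x v
  proof -
    interpret prob_space "\<pi> (Suc s) (x, v)" by (rule kernel[OF that])
    show int: "integrable (\<pi> (Suc s) (x, v)) k"
      using km kb kernel(2)[OF that] by (intro integrable_const_bound[where B = 1]) (auto cong: measurable_cong_sets)
    show "0 \<le> (\<integral>y. k y \<partial>\<pi> (Suc s) (x, v))" using kb by (intro Bochner_Integration.integral_nonneg) auto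
    show "(\<integral>y. k y \<partial>\<pi> (Suc s) (x, v)) \<le> 1" using kb by (intro integral_le_const int) auto
  qed
  have gen: "generator \<pi> \<phi> (s, x, v) =
      of_bool (Suc s = t) * (\<integral>y. k y \<partial>\<pi> (Suc s) (x, v)) - of_bool (s = t) * k (x, v)"
    if "s < T" "v \<in> W" for s x v
  proof -
    interpret prob_space "\<pi> (Suc s) (x, v)" by (rule kernel[OF that])
    have "generator \<pi> \<phi> (s, x, v) = (\<integral>y. of_bool (Suc s = t) * k y - of_bool (s = t) * k (x, v) \<partial>\<pi> (Suc s) (x, v))"
      by (simp add: generator_def \<phi> case_prod_beta')
    also have "\<dots> = of_bool (Suc s = t) * (\<integral>y. k y \<partial>\<pi> (Suc s) (x, v)) - of_bool (s = t) * k (x, v)"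
      using kint(1)[OF that] by (simp add: prob_space)
    finally show ?thesis .
  qed
  have gen_int: "(\<integral>x. generator \<pi> \<phi> (s, x, v) \<partial>m s v) =
      of_bool (Suc s = t) * (\<integral>x. (\<integral>y. k y \<partial>\<pi> (Suc s) (x, v)) \<partial>m s v) - of_bool (s = t) * (\<integral>x. k (x, v) \<partial>m s v)"
    if s: "s < T" and v: "v \<in> ?\<Omega> s" for s v
  proof -
    have "m s v \<in> subprobs D" using R s v by (auto simp: constraint_set_def PiE_iff)
    then interpret subprob_space "m s v" by (simp add: subprobs_iff)
    have sec: "(\<lambda>x. (x, v)) \<in> m s v \<rightarrow>\<^sub>M state_algebra W"
      using \<open>m s v \<in> subprobs D\<close> \<Omega>W[OF v] by (intro section_measurable_state_algebra) (auto simp: subprobs_iff)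
    have i1: "integrable (m s v) (\<lambda>x. k (x, v))"
      using kb by (intro integrable_const_bound[where B = 1] measurable_compose[OF sec km]) auto
    have "(\<lambda>y. integral\<^sup>L (\<pi> (Suc s) y) k) \<in> borel_measurable (state_algebra W)"
      using s by (intro measurable_compose[OF measurable_prob_algebraD[OF pi] integral_measurable_subprob_algebra[OF km]]) simp
    then have "(\<lambda>x. \<integral>y. k y \<partial>\<pi> (Suc s) (x, v)) \<in> borel_measurable (m s v)"
      by (rule measurable_compose[OF sec])
    then have i2: "integrable (m s v) (\<lambda>x. \<integral>y. k y \<partial>\<pi> (Suc s) (x, v))"
      using kint(2,3)[OF s \<Omega>W[OF v]] by (intro integrable_const_bound[where B = 1]) auto
    have "(\<integral>x. generator \<pi> \<phi> (s, x, v) \<partial>m s v) =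
      (\<integral>x. of_bool (Suc s = t) * (\<integral>y. k y \<partial>\<pi> (Suc s) (x, v)) - of_bool (s = t) * k (x, v) \<partial>m s v)"
      using s \<Omega>W[OF v] by (simp add: gen)
    then show ?thesis using i1 i2 by simp
  qed
  have "(\<Sum>s=0..T. \<Sum>v\<in>?\<Omega> s. ?p s v * (\<integral>x. \<phi> (s, x, v) \<partial>\<mu> s v)) =
      (\<Sum>v\<in>?\<Omega> 0. ?p 0 v * (LINT x:D|init_cond_law M X U v. \<phi> (0, x, v))) +
      (\<Sum>s\<in>{0..<T}. \<Sum>v\<in>?\<Omega> s. ?p s v * (\<integral>x. generator \<pi> \<phi> (s, x, v) \<partial>m s v))"
    using R slot_test_function_continuous[OF h(1), of "{0..T}" W t u]
    unfolding constraint_set_def \<phi>_def by blast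
  also have "(\<Sum>s=0..T. \<Sum>v\<in>?\<Omega> s. ?p s v * (\<integral>x. \<phi> (s, x, v) \<partial>\<mu> s v)) =
      (\<Sum>s=0..T. if s = t then (\<Sum>v\<in>?\<Omega> t. ?p t v * (\<integral>x. k (x, v) \<partial>\<mu> t v)) else 0)"
    by (intro sum.cong refl) (simp add: \<phi>)
  also have "\<dots> = (\<Sum>v\<in>?\<Omega> t. ?p t v * (\<integral>x. k (x, v) \<partial>\<mu> t v))"
    using t by simp
  also have "(\<Sum>v\<in>?\<Omega> 0. ?p 0 v * (LINT x:D|init_cond_law M X U v. \<phi> (0, x, v))) =
      (if t = 0 then \<Sum>v\<in>?\<Omega> 0. ?p 0 v * (LINT x:D|init_cond_law M X U v. k (x, v)) else 0)"
    by (simp add: \<phi>)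
  also have "(\<Sum>s\<in>{0..<T}. \<Sum>v\<in>?\<Omega> s. ?p s v * (\<integral>x. generator \<pi> \<phi> (s, x, v) \<partial>m s v)) =
      (\<Sum>s\<in>{0..<T}. (if Suc s = t then \<Sum>v\<in>?\<Omega> s. ?p s v * (\<integral>x. (\<integral>y. k y \<partial>\<pi> t (x, v)) \<partial>m s v) else 0)) -
      (\<Sum>s\<in>{0..<T}. (if s = t then \<Sum>v\<in>?\<Omega> t. ?p t v * (\<integral>x. k (x, v) \<partial>m t v) else 0))"
    unfolding sum_subtractf[symmetric]
  proof (rule sum.cong[OF refl])
    fix s assume "s \<in> {0..<T}"
    then have "(\<Sum>v\<in>?\<Omega> s. ?p s v * (\<integral>x. generator \<pi> \<phi> (s, x, v) \<partial>m s v)) =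
      (\<Sum>v\<in>?\<Omega> s. ?p s v * (of_bool (Suc s = t) * (\<integral>x. (\<integral>y. k y \<partial>\<pi> (Suc s) (x, v)) \<partial>m s v)) -
        ?p s v * (of_bool (s = t) * (\<integral>x. k (x, v) \<partial>m s v)))"
      by (intro sum.cong refl) (simp only: gen_int atLeastLessThan_iff right_diff_distrib)
    then show "(\<Sum>v\<in>?\<Omega> s. ?p s v * (\<integral>x. generator \<pi> \<phi> (s, x, v) \<partial>m s v)) =
      (if Suc s = t then \<Sum>v\<in>?\<Omega> s. ?p s v * (\<integral>x. (\<integral>y. k y \<partial>\<pi> t (x, v)) \<partial>m s v) else 0) -
      (if s = t then \<Sum>v\<in>?\<Omega> t. ?p t v * (\<integral>x. k (x, v) \<partial>m t v) else 0)"
      by (auto simp: sum_subtractf)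
  qed
  also have "(\<Sum>s\<in>{0..<T}. (if s = t then \<Sum>v\<in>?\<Omega> t. ?p t v * (\<integral>x. k (x, v) \<partial>m t v) else 0)) =
      (if t < T then \<Sum>v\<in>?\<Omega> t. ?p t v * (\<integral>x. k (x, v) \<partial>m t v) else 0)"
    by simp
  also have "(\<Sum>s\<in>{0..<T}. (if Suc s = t then \<Sum>v\<in>?\<Omega> s. ?p s v * (\<integral>x. (\<integral>y. k y \<partial>\<pi> t (x, v)) \<partial>m s v) else 0)) =
      (case t of 0 \<Rightarrow> 0 | Suc r \<Rightarrow> \<Sum>v\<in>?\<Omega> r. ?p r v * (\<integral>x. (\<integral>y. k y \<partial>\<pi> t (x, v)) \<partial>m r v))"
    using t by (cases t) (simp_all)
  finally show ?thesis
    by (cases t) auto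
qed

text \<open>
  The mass still running after \<open>t\<close>. The family \<open>m\<close> stops at \<open>T - 1\<close>; the value \<open>0\<close> from time \<open>T\<close> on
  makes the balance equation uniform in \<open>t \<le> T\<close>.
\<close>

definition running_mass ::
    "nat \<Rightarrow> 'u set \<Rightarrow> 'a measure \<Rightarrow> (nat \<Rightarrow> 'a \<Rightarrow> 'u) \<Rightarrow>
     (nat \<Rightarrow> 'u \<Rightarrow> 'e::topological_space measure) \<Rightarrow> nat \<Rightarrow> ('e \<times> 'u) measure" where
  "running_mass T W M U m t =
     (if t < T then attach_noise W (noise_supp W M U t) (noise_prob M U t) (m t)
      else null_measure (state_algebra W))"

definition arriving_mass ::
    "nat \<Rightarrow> 'u set \<Rightarrow> 'a measure \<Rightarrow> (nat \<Rightarrow> 'a \<Rightarrow> 'e) \<Rightarrow> (nat \<Rightarrow> 'a \<Rightarrow> 'u) \<Rightarrow>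
     (nat \<Rightarrow> 'e \<times> 'u \<Rightarrow> ('e \<times> 'u) measure) \<Rightarrow>
     (nat \<Rightarrow> 'u \<Rightarrow> 'e::topological_space measure) \<Rightarrow> nat \<Rightarrow> ('e \<times> 'u) measure" where
  "arriving_mass T W M X U \<pi> m t =
     (case t of 0 \<Rightarrow> distr M (state_algebra W) (\<lambda>\<omega>. (X 0 \<omega>, U 0 \<omega>))
      | Suc r \<Rightarrow> running_mass T W M U m r \<bind> \<pi> t)"

text \<open>
  \<open>constraint_balance\<close> says that both sides of \<open>mass_balance\<close> give the same integral to every test
  function on one slice, and such functions determine a finite measure on the state space. The initial
  term of the constraint integrates over \<open>D\<close> only; as \<open>X 0\<close> lies in \<open>D\<close> almost surely, it is the
  integral against the whole initial law.
\<close>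

lemma
  fixes X :: "nat \<Rightarrow> 'a \<Rightarrow> 'e::metric_space" and U :: "nat \<Rightarrow> 'a \<Rightarrow> 'u"
  assumes M: "complete_filtered_prob_space T M F" and chain: "markov_chain T W M F \<pi> X U"
    and W: "finite W" and D: "D \<in> sets borel" and X0: "AE \<omega> in M. X 0 \<omega> \<in> D"
    and R: "(\<mu>, m) \<in> constraint_set T D W M X U \<pi>" and t: "t \<le> T"
  shows running_mass_subprob: "running_mass T W M U m t \<in> space (subprob_algebra (state_algebra W))"
    and arriving_mass_subprob: "arriving_mass T W M X U \<pi> m t \<in> space (subprob_algebra (state_algebra W))"
    and mass_balance: "\<And>C. C \<in> sets (state_algebra W) \<Longrightarrow>
      emeasure (attach_noise W (noise_supp W M U t) (noise_prob M U t) (\<mu> t)) C +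
        emeasure (running_mass T W M U m t) C =
      emeasure (arriving_mass T W M X U \<pi> m t) C"
proof -
  let ?S = "state_algebra W :: ('e \<times> 'u) measure"
  let ?running = "running_mass T W M U m" and ?arriving = "arriving_mass T W M X U \<pi> m"
  let ?\<Omega> = "noise_supp W M U" and ?p = "noise_prob M U"
  have prob: "prob_space M" using M by (simp add: complete_filtered_prob_space_def)
  have XU: "(\<lambda>\<omega>. (X s \<omega>, U s \<omega>)) \<in> M \<rightarrow>\<^sub>M ?S" if "s \<le> T" for s
    using M chain that by (rule markov_chain_measurable)
  have pi: "\<And>s. s \<in> {1..T} \<Longrightarrow> \<pi> s \<in> ?S \<rightarrow>\<^sub>M prob_algebra ?S"
    using chain by (simp add: markov_chain_def)
  have \<Omega>: "finite (?\<Omega> s)" "?\<Omega> s \<noteq> {}" "?\<Omega> s \<subseteq> W" "sum (?p s) (?\<Omega> s) \<le> 1" if "s \<le> T" for s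
    using noise_supp_subset[where t = s and X = X and U = U, OF prob W XU[OF that]] noise_supp_not_empty[where t = s and X = X and U = U, OF prob W XU[OF that]]
      sum_noise_prob[where t = s and X = X and U = U, OF prob W XU[OF that]] by auto
  have p: "0 \<le> ?p s v" for s v by (simp add: noise_prob_def)
  have \<mu>: "\<mu> s v \<in> subprobs UNIV" if "s \<le> T" "v \<in> ?\<Omega> s" for s v
    using R that by (auto simp: constraint_set_def PiE_iff)
  have m: "m s v \<in> subprobs D" if "s < T" "v \<in> ?\<Omega> s" for s v
    using R that by (auto simp: constraint_set_def PiE_iff)
  have ne: "space ?S \<noteq> {}" using \<Omega>[of 0] by (auto simp: space_state_algebra)
  define stopped where "stopped = attach_noise W (?\<Omega> t) (?p t) (\<mu> t)"
  have stopped_sub: "stopped \<in> space (subprob_algebra ?S)"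
    unfolding stopped_def
    by (rule attach_noise_in_subprob_algebra[where K = UNIV]) (use \<Omega>[OF t] p \<mu>[OF t] in auto)
  have running_sub: "?running s \<in> space (subprob_algebra ?S)" if "s \<le> T" for s
  proof (cases "s < T")
    case True
    have "attach_noise W (?\<Omega> s) (?p s) (m s) \<in> space (subprob_algebra ?S)"
      by (rule attach_noise_in_subprob_algebra[where K = D]) (use \<Omega>[OF that] p m[OF True] in auto)
    then show ?thesis using True by (simp add: running_mass_def)
  next
    case False
    then show ?thesis
      using ne by (auto simp: running_mass_def space_subprob_algebra intro!: subprob_spaceI)
  qed
  have arriving_sub: "?arriving t \<in> space (subprob_algebra ?S)"
  proof (cases t)
    case 0
    then show ?thesis
      using prob_space.prob_space_distr[OF prob XU[of 0]]
      by (simp add: arriving_mass_def space_subprob_algebra prob_space_imp_subprob_space)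
  next
    case (Suc r)
    have r: "r \<le> T" using Suc t by simp
    have sets_r: "sets (?running r) = sets ?S" using running_sub[OF r] by (simp add: space_subprob_algebra)
    have K: "\<pi> (Suc r) \<in> ?running r \<rightarrow>\<^sub>M subprob_algebra ?S"
      using measurable_prob_algebraD[OF pi[of "Suc r"]] Suc t by (simp add: measurable_cong_sets[OF sets_r refl])
    have "subprob_space (?running r \<bind> \<pi> (Suc r))"
      using running_sub[OF r] by (intro subprob_space_bind[OF _ K]) (simp add: space_subprob_algebra)
    moreover have "sets (?running r \<bind> \<pi> (Suc r)) = sets ?S"
      using K ne sets_eq_imp_space_eq[OF sets_r] by (intro sets_bind) (simp_all add: sets_kernel[OF K])
    ultimately show ?thesis by (simp add: arriving_mass_def Suc space_subprob_algebra)
  qed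
  \<comment> \<open>the sum of two measures, as a mixture with both weights equal to \<open>1\<close>\<close>
  define both where "both = mixture UNIV (\<lambda>_. 1) (\<lambda>b. if b then stopped else ?running t)"
  have parts: "(if b then stopped else ?running t) \<in> space (subprob_algebra ?S)" for b
    using stopped_sub running_sub[OF t] by simp
  have sets_both: "sets both = sets ?S"
    unfolding both_def by (rule sets_mixture) (use parts in simp_all)
  have both_em: "emeasure both C = emeasure stopped C + emeasure (?running t) C" if "C \<in> sets ?S" for C
    unfolding both_def
    by (subst emeasure_mixture[where S = ?S]) (use parts that in \<open>simp_all add: UNIV_bool add.commute\<close>)
  have "both = ?arriving t"
  proof (rule finite_state_measure_eqI[OF W])
    show "sets both = sets ?S" "sets (?arriving t) = sets ?S"
      using arriving_sub sets_both by (simp_all add: space_subprob_algebra)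
    show "finite_measure (?arriving t)"
      using arriving_sub by (simp add: space_subprob_algebra subprob_space_def)
    show "finite_measure both"
    proof (rule finite_measureI)
      have "emeasure stopped (space ?S) \<le> 1" "emeasure (?running t) (space ?S) \<le> 1"
        using stopped_sub running_sub[OF t] by (auto simp: space_subprob_algebra intro: subprob_space.subprob_emeasure_le_1)
      then have "emeasure both (space ?S) \<le> 1 + 1"
        by (simp only: both_em sets.top) (rule add_mono)
      then show "emeasure both (space both) \<noteq> \<infinity>"
        using sets_eq_imp_space_eq[OF sets_both] by (auto simp: top_unique)
    qed
    fix h :: "'e \<Rightarrow> real" and u assume h: "continuous_on UNIV h" "\<And>x. 0 \<le> h x \<and> h x \<le> 1" and u: "u \<in> W"
    define k where "k = (\<lambda>s. h (fst s) * of_bool (snd s = u))"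
    have [measurable]: "h \<in> borel_measurable borel" using h(1) by (rule borel_measurable_continuous_onI)
    have km [measurable]: "k \<in> borel_measurable ?S"
      unfolding k_def using h(1) by (rule slot_function_measurable)
    have kb: "0 \<le> k s" "k s \<le> 1" for s using h(2)[of "fst s"] by (auto simp: k_def)
    have int_running: "(\<integral>\<^sup>+s. ennreal (f s) \<partial>?running r) =
        ennreal (if r < T then \<Sum>v\<in>?\<Omega> r. ?p r v * (\<integral>x. f (x, v) \<partial>m r v) else 0)"
      if "r \<le> T" "f \<in> borel_measurable ?S" "\<And>s. s \<in> UNIV \<times> W \<Longrightarrow> 0 \<le> f s \<and> f s \<le> 1" for r f
    proof (cases "r < T")
      case True
      then show ?thesis
        using \<Omega>[OF \<open>r \<le> T\<close>] p m[OF True] that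
        by (simp add: running_mass_def nn_integral_attach_noise[where K = D])
    qed (use that in \<open>simp add: running_mass_def nn_integral_null_measure\<close>)
    have "(\<integral>\<^sup>+s. ennreal (k s) \<partial>both) = (\<integral>\<^sup>+s. ennreal (k s) \<partial>stopped) + (\<integral>\<^sup>+s. ennreal (k s) \<partial>?running t)"
      unfolding both_def
      by (subst nn_integral_mixture[where S = ?S]) (use parts in \<open>simp_all add: UNIV_bool add.commute\<close>)
    also have "(\<integral>\<^sup>+s. ennreal (k s) \<partial>stopped) = ennreal (\<Sum>v\<in>?\<Omega> t. ?p t v * (\<integral>x. k (x, v) \<partial>\<mu> t v))"
      unfolding stopped_def
      by (rule nn_integral_attach_noise[where K = UNIV]) (use \<Omega>[OF t] p \<mu>[OF t] km kb in auto)
    also have "(\<integral>\<^sup>+s. ennreal (k s) \<partial>?running t) =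
        ennreal (if t < T then \<Sum>v\<in>?\<Omega> t. ?p t v * (\<integral>x. k (x, v) \<partial>m t v) else 0)"
      by (rule int_running) (use t km kb in auto)
    also have "ennreal (\<Sum>v\<in>?\<Omega> t. ?p t v * (\<integral>x. k (x, v) \<partial>\<mu> t v)) + \<dots> =
        ennreal ((\<Sum>v\<in>?\<Omega> t. ?p t v * (\<integral>x. k (x, v) \<partial>\<mu> t v)) +
          (if t < T then \<Sum>v\<in>?\<Omega> t. ?p t v * (\<integral>x. k (x, v) \<partial>m t v) else 0))"
      using p kb by (intro ennreal_plus[symmetric])
        (auto intro!: sum_nonneg mult_nonneg_nonneg Bochner_Integration.integral_nonneg)
    also have "\<dots> = ennreal (case t of 0 \<Rightarrow> (\<Sum>v\<in>?\<Omega> 0. ?p 0 v * (LINT x:D|init_cond_law M X U v. k (x, v)))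
        | Suc r \<Rightarrow> (\<Sum>v\<in>?\<Omega> r. ?p r v * (\<integral>x. (\<integral>s. k s \<partial>\<pi> t (x, v)) \<partial>m r v)))"
      using constraint_balance[OF R pi h t, of u] by (simp only: k_def)
    also have "\<dots> = (\<integral>\<^sup>+s. ennreal (k s) \<partial>?arriving t)"
    proof (cases t)
      case 0
      have set_int: "(LINT x:D|init_cond_law M X U v. k (x, v)) = (\<integral>x. k (x, v) \<partial>init_cond_law M X U v)"
        if v: "v \<in> ?\<Omega> 0" for v
        unfolding set_lebesgue_integral_def
      proof (rule integral_cong_AE)
        have [measurable]: "(\<lambda>x. k (x, v)) \<in> borel_measurable borel" unfolding k_def by simp
        have [measurable_cong]: "sets (init_cond_law M X U v) = sets borel" by (simp add: init_cond_law_def)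
        show "(\<lambda>x. indicat_real D x *\<^sub>R k (x, v)) \<in> borel_measurable (init_cond_law M X U v)"
          "(\<lambda>x. k (x, v)) \<in> borel_measurable (init_cond_law M X U v)"
          using D by measurable
        show "AE x in init_cond_law M X U v. indicat_real D x *\<^sub>R k (x, v) = k (x, v)"
          using AE_init_cond_law[where X = X and U = U, OF prob W XU[OF le0] v D X0] by eventually_elim simp
      qed
      have "(\<integral>\<^sup>+s. ennreal (k s) \<partial>?arriving t) = ennreal (\<Sum>v\<in>?\<Omega> 0. ?p 0 v * (\<integral>x. k (x, v) \<partial>init_cond_law M X U v))"
        unfolding arriving_mass_def 0 nat.case initial_law_eq_attach_noise[where X = X and U = U, OF prob W XU[OF le0]]
        by (rule nn_integral_attach_noise[where K = UNIV])
          (use \<Omega>[of 0] p init_cond_law_prob(2)[where X = X and U = U, OF prob W XU[OF le0]] km kb in auto)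
      then show ?thesis using set_int by (simp add: 0)
    next
      case (Suc r)
      have r: "r < T" using Suc t by simp
      have sets_r: "sets (?running r) = sets ?S" using running_sub[of r] r by (simp add: space_subprob_algebra)
      have K: "\<pi> (Suc r) \<in> ?S \<rightarrow>\<^sub>M subprob_algebra ?S"
        using measurable_prob_algebraD[OF pi[of "Suc r"]] r by simp
      then have Kr: "\<pi> (Suc r) \<in> ?running r \<rightarrow>\<^sub>M subprob_algebra ?S"
        by (simp add: measurable_cong_sets[OF sets_r refl])
      have int_pi: "(\<integral>\<^sup>+y. ennreal (k y) \<partial>\<pi> (Suc r) s) = ennreal (\<integral>y. k y \<partial>\<pi> (Suc r) s)"
        "0 \<le> (\<integral>y. k y \<partial>\<pi> (Suc r) s)" "(\<integral>y. k y \<partial>\<pi> (Suc r) s) \<le> 1" if "s \<in> space ?S" for s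
      proof -
        have *: "prob_space (\<pi> (Suc r) s)" "sets (\<pi> (Suc r) s) = sets ?S"
          using measurable_space[OF pi[of "Suc r"] that] r by (auto simp: space_prob_algebra)
        interpret prob_space "\<pi> (Suc r) s" by (rule *)
        have int: "integrable (\<pi> (Suc r) s) k"
          using kb *(2) by (intro integrable_const_bound[where B = 1]) (auto cong: measurable_cong_sets)
        show "(\<integral>\<^sup>+y. ennreal (k y) \<partial>\<pi> (Suc r) s) = ennreal (\<integral>y. k y \<partial>\<pi> (Suc r) s)"
          using kb by (intro nn_integral_eq_integral int) auto
        show "0 \<le> (\<integral>y. k y \<partial>\<pi> (Suc r) s)" using kb by (intro Bochner_Integration.integral_nonneg) auto
        show "(\<integral>y. k y \<partial>\<pi> (Suc r) s) \<le> 1" using kb by (intro integral_le_const int) auto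
      qed
      have "(\<integral>\<^sup>+s. ennreal (k s) \<partial>?arriving t) = (\<integral>\<^sup>+s. \<integral>\<^sup>+y. ennreal (k y) \<partial>\<pi> (Suc r) s \<partial>?running r)"
        unfolding arriving_mass_def Suc nat.case by (rule nn_integral_bind[OF _ Kr]) simp
      also have "\<dots> = (\<integral>\<^sup>+s. ennreal (\<integral>y. k y \<partial>\<pi> (Suc r) s) \<partial>?running r)"
        using sets_eq_imp_space_eq[OF sets_r] by (intro nn_integral_cong) (simp add: int_pi)
      also have "\<dots> = ennreal (if r < T then \<Sum>v\<in>?\<Omega> r. ?p r v * (\<integral>x. (\<integral>y. k y \<partial>\<pi> (Suc r) (x, v)) \<partial>m r v) else 0)"
      proof (rule int_running)
        show "(\<lambda>s. \<integral>y. k y \<partial>\<pi> (Suc r) s) \<in> borel_measurable ?S"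
          by (rule measurable_compose[OF K integral_measurable_subprob_algebra[OF km]])
      qed (use r int_pi in \<open>auto simp: space_state_algebra\<close>)
      finally show ?thesis using r by (simp add: Suc)
    qed
    finally show "(\<integral>\<^sup>+s. ennreal (h (fst s) * of_bool (snd s = u)) \<partial>both) =
        (\<integral>\<^sup>+s. ennreal (h (fst s) * of_bool (snd s = u)) \<partial>?arriving t)"
      by (simp add: k_def)
  qed
  then show "\<And>C. C \<in> sets ?S \<Longrightarrow>
      emeasure (attach_noise W (?\<Omega> t) (?p t) (\<mu> t)) C + emeasure (?running t) C = emeasure (?arriving t) C"
    using both_em by (simp add: stopped_def)
  show "?running t \<in> space (subprob_algebra ?S)" by (rule running_sub[OF t])
  show "?arriving t \<in> space (subprob_algebra ?S)" by (rule arriving_sub)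
qed

section \<open>The representation\<close>

text \<open>
  By the balance equation the running mass is dominated by the arriving mass. It is carried by
  \<open>D \<times> W\<close>, so its density may be multiplied by the indicator of \<open>D\<close>.
\<close>

lemma survival_probability_exists:
  fixes X :: "nat \<Rightarrow> 'a \<Rightarrow> 'e::metric_space" and U :: "nat \<Rightarrow> 'a \<Rightarrow> 'u"
  assumes M: "complete_filtered_prob_space T M F" and chain: "markov_chain T W M F \<pi> X U"
    and W: "finite W" and D: "D \<in> sets borel" and X0: "AE \<omega> in M. X 0 \<omega> \<in> D"
    and R: "(\<mu>, m) \<in> constraint_set T D W M X U \<pi>" and t: "t \<le> T"
  shows "\<exists>a. a \<in> borel_measurable (state_algebra W) \<and> (\<forall>s. 0 \<le> a s \<and> a s \<le> (1::real)) \<and>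
    (\<forall>x v. x \<notin> D \<or> t = T \<longrightarrow> a (x, v) = 0) \<and>
    density (arriving_mass T W M X U \<pi> m t) (\<lambda>s. ennreal (a s)) = running_mass T W M U m t"
proof -
  let ?S = "state_algebra W :: ('e \<times> 'u) measure"
  let ?run = "running_mass T W M U m t" and ?arr = "arriving_mass T W M X U \<pi> m t"
  have sets: "sets ?run = sets ?S" "sets ?arr = sets ?S" "subprob_space ?arr"
    using running_mass_subprob[OF assms] arriving_mass_subprob[OF assms] by (auto simp: space_subprob_algebra)
  note [measurable_cong] = sets(2)
  have prob: "prob_space M" using M by (simp add: complete_filtered_prob_space_def)
  note XU = markov_chain_measurable[OF M chain t]
  show ?thesis
  proof (cases "t < T")
    case False
    have "density ?arr (\<lambda>s. ennreal 0) = ?run"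
      by (rule measure_eqI) (use False sets in \<open>auto simp: running_mass_def emeasure_density\<close>)
    then show ?thesis by (intro exI[of _ "\<lambda>_. 0"]) auto
  next
    case True
    have "emeasure ?run C \<le> emeasure ?arr C" if "C \<in> sets ?arr" for C
      using mass_balance[OF assms, of C, symmetric] that sets(2) by simp
    then obtain a where a [measurable]: "a \<in> borel_measurable ?arr" and ab: "\<And>s. 0 \<le> a s \<and> a s \<le> (1::real)"
      and dens: "?run = density ?arr (\<lambda>s. ennreal (a s))"
      using density_of_dominated_measure[of ?arr ?run] sets by (auto simp: subprob_space_def)
    define b where "b s = a s * indicator D (fst s)" for s
    have DW: "D \<times> W \<in> sets ?S"
      unfolding state_algebra_def using D by (intro pair_measureI) auto
    have [measurable]: "(\<lambda>s. indicator D (fst s) :: real) \<in> borel_measurable ?S"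
      using D unfolding state_algebra_def by measurable
    have b [measurable]: "b \<in> borel_measurable ?S"
      using a unfolding b_def by (simp add: measurable_cong_sets[OF sets(2) refl])
    have \<Omega>: "finite (noise_supp W M U t)" "noise_supp W M U t \<noteq> {}" "noise_supp W M U t \<subseteq> W"
      using noise_supp_subset[where t = t and X = X and U = U, OF prob W XU]
        noise_supp_not_empty[where t = t and X = X and U = U, OF prob W XU] by auto
    have m: "m t v \<in> subprobs D" if "v \<in> noise_supp W M U t" for v
      using R True that by (auto simp: constraint_set_def PiE_iff)
    have "density ?arr (\<lambda>s. ennreal (b s)) = ?run"
    proof (rule measure_eqI)
      show "sets (density ?arr (\<lambda>s. ennreal (b s))) = sets ?run" using sets by simp
      fix C assume "C \<in> sets (density ?arr (\<lambda>s. ennreal (b s)))"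
      then have C: "C \<in> sets ?S" using sets by simp
      have "emeasure (density ?arr (\<lambda>s. ennreal (b s))) C = (\<integral>\<^sup>+s. ennreal (b s) * indicator C s \<partial>?arr)"
      proof (rule emeasure_density)
        have "(\<lambda>s. ennreal (b s)) \<in> borel_measurable ?S"
          by (rule measurable_compose[OF b measurable_ennreal])
        then show "(\<lambda>s. ennreal (b s)) \<in> borel_measurable ?arr"
          by (simp only: measurable_cong_sets[OF sets(2) refl])
        show "C \<in> sets ?arr" using C by (simp only: sets(2))
      qed
      also have "\<dots> = (\<integral>\<^sup>+s. ennreal (a s) * indicator (C \<inter> D \<times> W) s \<partial>?arr)"
      proof (rule nn_integral_cong)
        fix s assume "s \<in> space ?arr"
        then have "s \<in> UNIV \<times> W" by (simp only: sets_eq_imp_space_eq[OF sets(2)] space_state_algebra)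
        then have "snd s \<in> W" by auto
        then show "ennreal (b s) * indicator C s = ennreal (a s) * indicator (C \<inter> D \<times> W) s"
          by (cases "fst s \<in> D"; cases "s \<in> C") (simp_all add: b_def mem_Times_iff)
      qed
      also have "\<dots> = emeasure ?run (C \<inter> D \<times> W)"
        unfolding dens using C DW sets by (intro emeasure_density[symmetric]) auto
      also have "\<dots> = emeasure ?run C"
      proof -
        have "{x\<in>space (m t v). (x, v) \<in> C \<inter> D \<times> W} = {x\<in>space (m t v). (x, v) \<in> C}"
          if "v \<in> noise_supp W M U t" for v
        proof -
          have "space (m t v) = D"
            using m[OF that] sets_eq_imp_space_eq[of "m t v" "restrict_space borel D"]
            by (simp add: subprobs_iff space_restrict_space)
          moreover have "v \<in> W" using that \<Omega> by auto
          ultimately show ?thesis by auto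
        qed
        then show ?thesis
          using \<Omega> m C DW True
          by (simp add: running_mass_def emeasure_attach_noise[where K = D] noise_prob_def)
      qed
      finally show "emeasure (density ?arr (\<lambda>s. ennreal (b s))) C = emeasure ?run C" .
    qed
    then show ?thesis
      using True ab b by (intro exI[of _ b]) (auto simp: b_def indicator_def)
  qed
qed

text \<open>
  The killed chain with survival probabilities from \<open>survival_probability_exists\<close>: its arrivals are
  the arriving masses of the constraint, and its survivors are the running masses.
\<close>

theorem theorem2p8:
  fixes T :: nat
    and D :: "'e::metric_space set"
    and H :: "'h set" and z :: "nat \<Rightarrow> 'h"
    and M :: "'a measure" and F :: "nat \<Rightarrow> 'a measure"
    and X :: "nat \<Rightarrow> 'a \<Rightarrow> 'e" and Z :: "nat \<Rightarrow> 'a \<Rightarrow> 'h"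
    and W :: "noise_matrix set" and U :: "nat \<Rightarrow> 'a \<Rightarrow> noise_matrix"
    and \<pi> :: "nat \<Rightarrow> 'e \<times> noise_matrix \<Rightarrow> ('e \<times> noise_matrix) measure"
    and f g :: "nat \<Rightarrow> 'e \<times> noise_matrix \<times> 'e measure \<Rightarrow> real"
    and \<mu> m :: "nat \<Rightarrow> noise_matrix \<Rightarrow> 'e measure"
  assumes T: "T \<ge> 1"
    and E: "compact (UNIV :: 'e set)"
    and D: "compact D" "D \<noteq> {}"
    and H: "finite H" "H \<noteq> {}" "bij_betw z {1..card H} H"
    and M: "complete_filtered_prob_space T M F"
    and X: "\<And>t. t \<in> {0..T} \<Longrightarrow> X t \<in> F t \<rightarrow>\<^sub>M borel"
    and Z: "\<And>t. t \<in> {0..T} \<Longrightarrow> Z t \<in> F t \<rightarrow>\<^sub>M count_space H"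
    and W: "W = noise_matrices T (card H)"
    and U: "U = noise_process T (card H) z Z"
    and A1: "AE \<omega> in M. X 0 \<omega> \<in> D"
    and A2: "markov_chain T W M F \<pi> X U"
      "\<And>t x y u u'. \<lbrakk>t \<in> {1..T}; u \<in> W; u' \<in> W\<rbrakk> \<Longrightarrow>
         measure (\<pi> t (x, u)) (UNIV \<times> {u'}) = measure (\<pi> t (y, u)) (UNIV \<times> {u'})"
    and A3: "\<And>t. t \<in> {1..T} \<Longrightarrow>
       continuous_map (state_topology W)
         (weak_topology (state_topology W) (space (prob_algebra (state_algebra W)))) (\<pi> t)"
    and A4: "\<And>t. t \<in> {0..<T} \<Longrightarrow>
         continuous_map (prod_topology (top_of_set D)
           (prod_topology (discrete_topology W) (subprob_topology D))) euclideanreal (f t)"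
      "\<And>t. t \<in> {0..T} \<Longrightarrow>
         continuous_map (prod_topology euclidean
           (prod_topology (discrete_topology W) (subprob_topology UNIV))) euclideanreal (g t)"
    and R: "(\<mu>, m) \<in> constraint_set T D W M X U \<pi>"
  shows "\<exists>(M' :: (nat \<Rightarrow> 'e \<times> noise_matrix \<times> real) measure) F' \<tau>' X' U'.
      complete_filtered_prob_space T M' F' \<and>
      \<tau>' \<in> M' \<rightarrow>\<^sub>M count_space {0..T} \<and>
      (\<forall>t\<in>{0..T}. X' t \<in> M' \<rightarrow>\<^sub>M borel \<and> U' t \<in> M' \<rightarrow>\<^sub>M count_space W) \<and>
      markov_chain T W M' F' \<pi> X' U' \<and>
      (\<forall>A\<in>sets (state_algebra W).
         \<P>(\<omega> in M'. (X' 0 \<omega>, U' 0 \<omega>) \<in> A) =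
         (\<Sum>u\<in>noise_supp W M U 0.
            measure (init_cond_law M X U u) {x. (x, u) \<in> A} * noise_prob M U 0 u)) \<and>
      stopping_time_upto T F' M' \<tau>' \<and>
      (\<forall>\<omega>\<in>space M'. enat (\<tau>' \<omega>) \<le> exit_time T D X' \<omega>) \<and>
      (\<forall>t\<in>{0..<T}. \<forall>u\<in>noise_supp W M U t. \<forall>B\<in>sets (restrict_space borel D).
         measure (m t u) B = \<P>(\<omega> in M'. X' t \<omega> \<in> B \<and> t < \<tau>' \<omega> \<bar> U' t \<omega> = u)) \<and>
      (\<forall>t\<in>{0..T}. \<forall>u\<in>noise_supp W M U t. \<forall>B\<in>sets borel.
         measure (\<mu> t u) B = \<P>(\<omega> in M'. X' t \<omega> \<in> B \<and> \<tau>' \<omega> = t \<bar> U' t \<omega> = u))"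
proof -
  let ?S = "state_algebra W :: ('e \<times> noise_matrix) measure"
  let ?\<Omega> = "noise_supp W M U" and ?p = "noise_prob M U"
  let ?run = "running_mass T W M U m" and ?arr = "arriving_mass T W M X U \<pi> m"
  note chain = A2(1)
  have S: "borel \<Otimes>\<^sub>M count_space W = ?S" by (simp add: state_algebra_def)
  have fin: "finite W" unfolding W noise_matrices_def by (intro finite_PiE) auto
  have Db: "D \<in> sets borel" using D(1) by (simp add: compact_imp_closed)
  interpret M: prob_space M using M by (simp add: complete_filtered_prob_space_def)
  note prob = M.prob_space_axioms
  note XU = markov_chain_measurable[OF M chain]
  note \<Omega>W = noise_supp_subset[where X = X and U = U, OF prob fin XU]
  have pi: "\<And>s. s \<in> {1..T} \<Longrightarrow> \<pi> s \<in> ?S \<rightarrow>\<^sub>M prob_algebra ?S"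
    using chain by (simp add: markov_chain_def)
  note mass = M chain fin Db A1 R

  obtain a0 where a0: "\<And>t. t \<le> T \<Longrightarrow> a0 t \<in> borel_measurable ?S \<and> (\<forall>s. 0 \<le> a0 t s \<and> a0 t s \<le> (1::real)) \<and>
    (\<forall>x v. x \<notin> D \<or> t = T \<longrightarrow> a0 t (x, v) = 0) \<and> density (?arr t) (\<lambda>s. ennreal (a0 t s)) = ?run t"
    using survival_probability_exists[OF mass] by metis
  define a where "a t = (if t \<le> T then a0 t else (\<lambda>_. 0))" for t
  define K where "K t = (if t \<in> {1..T} then \<pi> t else return ?S)" for t
  define \<nu> where "\<nu> = distr M ?S (\<lambda>\<omega>. (X 0 \<omega>, U 0 \<omega>))"
  interpret killed_chain borel "count_space W" \<nu> K a
  proof (unfold_locales, unfold S)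
    show "\<nu> \<in> space (prob_algebra ?S)"
      using M.prob_space_distr[OF XU[OF le0]] by (simp add: \<nu>_def space_prob_algebra)
    show "K t \<in> ?S \<rightarrow>\<^sub>M prob_algebra ?S" for t
      using pi by (simp add: K_def measurable_return_prob_space)
    show "a t \<in> borel_measurable ?S" "0 \<le> a t s" "a t s \<le> 1" for t s
      using a0[of t] by (cases s; auto simp: a_def)+
  qed
  have a_eq: "a t = a0 t" if "t \<le> T" for t using that by (simp add: a_def)
  have K_eq: "K (Suc t) = \<pi> (Suc t)" if "Suc t \<le> T" for t using that by (simp add: K_def)
  have dead: "a T s = 0" for s using a0[of T] by (cases s) (auto simp: a_def)
  have arrival_eq: "arrival t = ?arr t" if "t \<le> T" for t
    using that
  proof (induction t)
    case 0
    then show ?case by (simp add: arriving_mass_def flip: \<nu>_def)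
  next
    case (Suc t)
    then have "density (arrival t) (\<lambda>s. ennreal (a t s)) = ?run t" "K (Suc t) = \<pi> (Suc t)"
      using a0[of t] by (simp_all only: a_eq Suc_leD K_eq)
    then show ?case by (simp add: arriving_mass_def)
  qed
  have survival_eq: "density (arrival t) (\<lambda>s. ennreal (a t s)) = ?run t" if "t \<le> T" for t
    using a0[OF that] by (simp only: arrival_eq[OF that] a_eq[OF that])

  define N where "N = path_law (Suc T)"
  define X' :: "nat \<Rightarrow> (nat \<Rightarrow> 'e \<times> noise_matrix \<times> real) \<Rightarrow> 'e" where "X' t \<omega> = fst (\<omega> t)" for t \<omega>
  define U' :: "nat \<Rightarrow> (nat \<Rightarrow> 'e \<times> noise_matrix \<times> real) \<Rightarrow> noise_matrix" where "U' t \<omega> = fst (snd (\<omega> t))" for t \<omega>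
  have state: "state (\<omega> t) = (X' t \<omega>, U' t \<omega>)" for \<omega> t
    by (simp add: state_def X'_def U'_def case_prod_beta)
  interpret N: prob_space N unfolding N_def by (rule prob_space_path_law)
  have prob_N': "prob_space (completion N)" by (rule prob_space_completion) (rule N.prob_space_axioms)
  have M': "complete_filtered_prob_space T (completion N) (completed_history T)"
    unfolding N_def by (rule complete_filtered_prob_space_paths)
  have chain': "markov_chain T W (completion N) (completed_history T) \<pi> X' U'"
    unfolding markov_chain_def
  proof (intro conjI ballI)
    show "(\<lambda>\<omega>. (X' t \<omega>, U' t \<omega>)) \<in> completed_history T t \<rightarrow>\<^sub>M ?S" if "t \<in> {0..T}" for t
      using state_measurable_completed_history[of t T] that by (simp add: state S)
    show "\<pi> t \<in> ?S \<rightarrow>\<^sub>M prob_algebra ?S" if "t \<in> {1..T}" for t using that by (rule pi)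
    fix t C assume t: "t \<in> {1..T}" and C: "C \<in> sets ?S"
    then obtain r where r: "t = Suc r" "Suc r \<le> T" by (cases t) auto
    show "AE \<omega> in completion N. real_cond_exp (completion N) (completed_history T (t - 1)) (\<lambda>\<omega>'. indicator C (X' t \<omega>', U' t \<omega>')) \<omega>
        = measure (\<pi> t (X' (t - 1) \<omega>, U' (t - 1) \<omega>)) C"
      using markov_property[OF r(2), of C] C
      unfolding S state K_eq[OF r(2)] r(1) diff_Suc_1 N_def completed_history_def by blast
  qed
  note XU' = markov_chain_measurable[OF M' chain']
  have alive0: "alive 0 \<omega>" for \<omega> by (simp add: alive_def)
  have dist0: "distr (completion N) ?S (\<lambda>\<omega>. (X' 0 \<omega>, U' 0 \<omega>)) = \<nu>"
  proof (rule measure_eqI)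
    show "sets (distr (completion N) ?S (\<lambda>\<omega>. (X' 0 \<omega>, U' 0 \<omega>))) = sets \<nu>" by (simp add: \<nu>_def)
    fix C assume "C \<in> sets (distr (completion N) ?S (\<lambda>\<omega>. (X' 0 \<omega>, U' 0 \<omega>)))"
    then have C: "C \<in> sets ?S" by simp
    have ev: "(\<lambda>\<omega>. (X' 0 \<omega>, U' 0 \<omega>)) -` C \<inter> space (completion N) = {\<omega>\<in>space N. alive 0 \<omega> \<and> state (\<omega> 0) \<in> C}"
      by (auto simp: alive0 state)
    have "{\<omega>\<in>space N. alive 0 \<omega> \<and> state (\<omega> 0) \<in> C} \<in> sets N"
      using alive_events(1)[of 0 T C] C unfolding S N_def by simp
    then have "emeasure (distr (completion N) ?S (\<lambda>\<omega>. (X' 0 \<omega>, U' 0 \<omega>))) C = emeasure N {\<omega>\<in>space N. alive 0 \<omega> \<and> state (\<omega> 0) \<in> C}"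
      using emeasure_distr[OF XU'[OF le0] C] unfolding ev by simp
    also have "\<dots> = emeasure \<nu> C"
      using emeasure_arrival[of 0 T C] C unfolding S N_def by simp
    finally show "emeasure (distr (completion N) ?S (\<lambda>\<omega>. (X' 0 \<omega>, U' 0 \<omega>))) C = emeasure \<nu> C" .
  qed
  have noise: "noise_prob (completion N) U' t u = ?p t u" if "t \<le> T" "u \<in> W" for t u
  proof -
    have "distr (completion N) ?S (\<lambda>\<omega>. (X' t \<omega>, U' t \<omega>)) = distr M ?S (\<lambda>\<omega>. (X t \<omega>, U t \<omega>))"
      by (rule markov_chain_marginals_unique[OF M' chain' M chain _ that(1)]) (use dist0 \<nu>_def in simp)
    then show ?thesis
      using noise_prob_eq_distr[where X = X and U = U, OF prob fin XU[OF that(1)] that(2)]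
        noise_prob_eq_distr[where X = X' and U = U', OF prob_N' fin XU'[OF that(1)] that(2)] by simp
  qed
  have le_kill: "n \<le> kill_time \<omega> \<longleftrightarrow> alive n \<omega>" for n \<omega>
    by (rule le_kill_time_iff[of T]) (simp add: survives_def dead)

  \<comment> \<open>A conditional probability given \<open>U' t = u\<close> is read off from the mass of the fibre over \<open>u\<close>.\<close>
  have conditional: "measure n B = \<P>(\<omega> in completion N. X' t \<omega> \<in> B \<and> P \<omega> \<bar> U' t \<omega> = u)"
    if t: "t \<le> T" and u: "u \<in> ?\<Omega> t" and "finite_measure n"
      and ev: "{\<omega>\<in>space N. P \<omega> \<and> state (\<omega> t) \<in> B \<times> {u}} \<in> sets N"
      and em: "emeasure N {\<omega>\<in>space N. P \<omega> \<and> state (\<omega> t) \<in> B \<times> {u}} = ennreal (?p t u) * emeasure n B"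
    for n B t u P
  proof -
    interpret n: finite_measure n by fact
    have pos: "?p t u > 0" and uW: "u \<in> W" using u by (auto simp: noise_supp_def)
    have "{\<omega>\<in>space (completion N). (X' t \<omega> \<in> B \<and> P \<omega>) \<and> U' t \<omega> = u} = {\<omega>\<in>space N. P \<omega> \<and> state (\<omega> t) \<in> B \<times> {u}}"
      by (auto simp: state)
    then have "\<P>(\<omega> in completion N. (X' t \<omega> \<in> B \<and> P \<omega>) \<and> U' t \<omega> = u) = measure N {\<omega>\<in>space N. P \<omega> \<and> state (\<omega> t) \<in> B \<times> {u}}"
      using ev by simp
    also have "\<dots> = ?p t u * measure n B"
      using em pos by (simp add: measure_def enn2real_mult)
    finally show ?thesis
      using noise[OF t uW] pos by (simp add: cond_prob_def noise_prob_def)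
  qed
  show ?thesis
  proof (intro exI conjI ballI)
    show "complete_filtered_prob_space T (completion N) (completed_history T)" by (rule M')
    show "kill_time \<in> completion N \<rightarrow>\<^sub>M count_space {0..T}"
      unfolding N_def by (rule kill_time_measurable) (rule dead)
    show "markov_chain T W (completion N) (completed_history T) \<pi> X' U'" by (rule chain')
    show "stopping_time_upto T (completed_history T) (completion N) kill_time"
      unfolding N_def by (rule stopping_time_kill_time) (rule dead)
    fix t assume "t \<in> {0..T}"
    then have XUt: "(\<lambda>\<omega>. (X' t \<omega>, U' t \<omega>)) \<in> completion N \<rightarrow>\<^sub>M borel \<Otimes>\<^sub>M count_space W"
      using XU'[of t] by (simp add: S)
    show "X' t \<in> completion N \<rightarrow>\<^sub>M borel" using measurable_compose[OF XUt measurable_fst] by simp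
    show "U' t \<in> completion N \<rightarrow>\<^sub>M count_space W" using measurable_compose[OF XUt measurable_snd] by simp
  next
    fix C assume C: "C \<in> sets ?S"
    have "\<P>(\<omega> in completion N. (X' 0 \<omega>, U' 0 \<omega>) \<in> C) = measure \<nu> C"
      unfolding dist0[symmetric] measure_distr[OF XU'[OF le0] C]
      by (intro arg_cong[where f = "measure (completion N)"]) auto
    also have "\<dots> = \<P>(\<omega> in M. (X 0 \<omega>, U 0 \<omega>) \<in> C)"
      unfolding \<nu>_def measure_distr[OF XU[OF le0] C]
      by (intro arg_cong[where f = "measure M"]) auto
    finally show "\<P>(\<omega> in completion N. (X' 0 \<omega>, U' 0 \<omega>) \<in> C) =
        (\<Sum>u\<in>?\<Omega> 0. measure (init_cond_law M X U u) {x. (x, u) \<in> C} * ?p 0 u)"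
      using measure_initial_law[where X = X and U = U, OF prob fin XU[OF le0] C] by simp
  next
    fix \<omega> assume "\<omega> \<in> space (completion N)"
    show "enat (kill_time \<omega>) \<le> exit_time T D X' \<omega>"
      unfolding exit_time_def
    proof (rule INF_greatest)
      fix t assume "t \<in> {t \<in> {0..T}. X' t \<omega> \<notin> D}"
      then have "a t (state (\<omega> t)) = 0" using a0[of t] by (auto simp: a_eq state)
      then have "\<not> survives t (\<omega> t)" by (simp add: survives_def)
      then have "kill_time \<omega> \<le> t" unfolding kill_time_def by (rule Least_le)
      then show "enat (kill_time \<omega>) \<le> enat t" by simp
    qed
  next
    fix t u B assume t: "t \<in> {0..<T}" and u: "u \<in> ?\<Omega> t" and B: "B \<in> sets (restrict_space borel D)"
    have m: "m s v \<in> subprobs D" if "s < T" "v \<in> ?\<Omega> s" for s v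
      using R that by (auto simp: constraint_set_def PiE_iff)
    have Bb: "B \<in> sets borel" and Bm: "B \<in> sets (m t u)"
      using B Db m[of t u] t u by (auto simp: sets_restrict_space_iff subprobs_iff)
    have tT: "t \<le> T" using t by simp
    have uW: "u \<in> W" using u by (simp add: noise_supp_def)
    have BS: "B \<times> {u} \<in> sets ?S" using Bb uW by (rule rectangle_in_state_algebra)
    show "measure (m t u) B = \<P>(\<omega> in completion N. X' t \<omega> \<in> B \<and> t < kill_time \<omega> \<bar> U' t \<omega> = u)"
      unfolding Suc_le_eq[symmetric] le_kill
    proof (rule conditional[OF tT u])
      show "finite_measure (m t u)" using m[of t u] t u by (simp add: subprobs_iff subprob_space_def)
      show "{\<omega>\<in>space N. alive (Suc t) \<omega> \<and> state (\<omega> t) \<in> B \<times> {u}} \<in> sets N"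
        unfolding N_def by (rule alive_events(2)[OF tT BS[folded S]])
      have "emeasure N {\<omega>\<in>space N. alive (Suc t) \<omega> \<and> state (\<omega> t) \<in> B \<times> {u}} = emeasure (?run t) (B \<times> {u})"
        unfolding N_def survival_eq[OF tT, symmetric] by (rule emeasure_survival[OF tT BS[folded S]])
      also have "\<dots> = ennreal (?p t u) * emeasure (m t u) B"
        using t u Bb Bm m[of t] \<Omega>W[OF tT] noise_supp_not_empty[where X = X and U = U, OF prob fin XU[OF tT]]
        by (simp add: running_mass_def emeasure_attach_noise_rectangle[where K = D] noise_prob_def)
      finally show "emeasure N {\<omega>\<in>space N. alive (Suc t) \<omega> \<and> state (\<omega> t) \<in> B \<times> {u}} = ennreal (?p t u) * emeasure (m t u) B" .
    qed
  next
    fix t u B assume t: "t \<in> {0..T}" and u: "u \<in> ?\<Omega> t" and B: "B \<in> sets (borel :: 'e measure)"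
    have tT: "t \<le> T" using t by simp
    have \<mu>: "\<mu> t v \<in> subprobs UNIV" if "v \<in> ?\<Omega> t" for v
      using R that t by (auto simp: constraint_set_def PiE_iff)
    have uW: "u \<in> W" using u by (simp add: noise_supp_def)
    have BS: "B \<times> {u} \<in> sets ?S" using B uW by (rule rectangle_in_state_algebra)
    \<comment> \<open>Stopping at \<open>t\<close> is the event \<open>P t - P (Suc t)\<close>: the arriving mass minus the running mass.\<close>
    define P where "P n = {\<omega>\<in>space N. alive n \<omega> \<and> state (\<omega> t) \<in> B \<times> {u}}" for n
    have P: "P t \<in> sets N" "P (Suc t) \<in> sets N"
      unfolding P_def N_def by (rule alive_events[OF tT BS[folded S]])+
    have sub: "P (Suc t) \<subseteq> P t" by (auto simp: P_def alive_def)
    have diff: "{\<omega>\<in>space N. kill_time \<omega> = t \<and> state (\<omega> t) \<in> B \<times> {u}} = P t - P (Suc t)"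
    proof -
      have *: "kill_time \<omega> = t \<longleftrightarrow> alive t \<omega> \<and> \<not> alive (Suc t) \<omega>" for \<omega>
        unfolding le_kill[symmetric] by auto
      show ?thesis
        by (rule set_eqI) (unfold P_def * Diff_iff mem_Collect_eq, argo)
    qed
    show "measure (\<mu> t u) B = \<P>(\<omega> in completion N. X' t \<omega> \<in> B \<and> kill_time \<omega> = t \<bar> U' t \<omega> = u)"
    proof (rule conditional[OF tT u])
      show "finite_measure (\<mu> t u)" using \<mu>[OF u] by (simp add: subprobs_iff subprob_space_def)
      show "{\<omega>\<in>space N. kill_time \<omega> = t \<and> state (\<omega> t) \<in> B \<times> {u}} \<in> sets N"
        unfolding diff using P by (rule sets.Diff)
      have "emeasure N (P t) = emeasure (?arr t) (B \<times> {u})"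
        unfolding P_def N_def arrival_eq[OF tT, symmetric] by (rule emeasure_arrival[OF tT BS[folded S]])
      also have "\<dots> = emeasure (attach_noise W (?\<Omega> t) (?p t) (\<mu> t)) (B \<times> {u}) + emeasure (?run t) (B \<times> {u})"
        by (rule mass_balance[OF mass tT BS, symmetric])
      also have "emeasure (?run t) (B \<times> {u}) = emeasure N (P (Suc t))"
        unfolding P_def N_def survival_eq[OF tT, symmetric] by (rule emeasure_survival[OF tT BS[folded S], symmetric])
      also have "emeasure (attach_noise W (?\<Omega> t) (?p t) (\<mu> t)) (B \<times> {u}) = ennreal (?p t u) * emeasure (\<mu> t u) B"
        by (rule emeasure_attach_noise_rectangle[where K = UNIV])
          (use u B \<mu> \<Omega>W[OF tT] in \<open>auto simp: noise_prob_def subprobs_iff sets_restrict_space\<close>)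
      finally have "emeasure N (P t) - emeasure N (P (Suc t)) = ennreal (?p t u) * emeasure (\<mu> t u) B"
        by (simp add: N.emeasure_finite)
      then show "emeasure N {\<omega>\<in>space N. kill_time \<omega> = t \<and> state (\<omega> t) \<in> B \<times> {u}} = ennreal (?p t u) * emeasure (\<mu> t u) B"
        unfolding diff using P sub by (simp add: emeasure_Diff)
    qed
  qed
qed

end
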